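(* Let $G$ be a countable infinite residually finite discrete group. Let $T$ be the nonsingular $(C,F)$-action of $G$ associated with admissible $(C,F)$-parameters $\mathcal T=(C_n,F_{n-1},\kappa_n,\nu_{n-1})_{n\ge1}$. Then $T$ has no nonsingular odometer factors if and only if for each decreasing sequence $\Gamma_1\supsetneq\Gamma_2\supsetneq\cdots$ of finite-index subgroups of $G$ satisfying $\bigcap_{n}\bigcap_{g\in G}g\Gamma_ng^{-1}=\{1_G\}$, no telescoping of $\mathcal T$ is compatible with the sequence $(\Gamma_n)_{n=1}^\infty$, i.e. for each sequence of integers $0=q_1<q_2<\cdots$, $$\sum_{n=1}^\infty\kappa_{q_n+1}*\cdots*\kappa_{q_{n+1}}\big(\{c\in C_{q_n+1}\cdots C_{q_{n+1}}: c\notin\Gamma_n\}\big)=\infty.$$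
   Context: **$(C,F)$-parameters.** $\mathcal T=(C_n,F_{n-1},\kappa_n,\nu_{n-1})_{n\ge1}$, where $C_n,F_n$ are finite subsets of $G$, $F_0=\{1_G\}$, $1_G\in F_n\cap C_n$ and $\#C_n>1$ for $n\ge 1$; $F_nC_{n+1}\subset F_{n+1}$ and $F_nc\cap F_nc'=\emptyset$ for distinct $c,c'\in C_{n+1}$, $n\ge0$; $\kappa_n$ is a probability on $C_n$ with full support, with $\prod_{n>0}\max_{c\in C_n}\kappa_n(c)=0$; $\nu_n$ is a finite measure on $F_n$ with full support, $\nu_0(1_G)=1$ and $\nu_{n+1}(fc)=\nu_n(f)\kappa_{n+1}(c)$ for $f\in F_n$, $c\in C_{n+1}$. They are admissible if for all $g\in G$, $n\ge0$: $\lim_{m\to\infty}\nu_m\big((F_nC_{n+1}\cdots C_m)\cap g^{-1}F_m\big)=\nu_n(F_n)$. The symbol $*$ is convolution of measures on $G$. **$(C,F)$-action.** Let $X_n=F_n\times C_{n+1}\times C_{n+2}\times\cdots$ (product topology), embedded into $X_{n+1}$ by $(f_n,c_{n+1},c_{n+2},\dots)\mapsto(f_nc_{n+1},c_{n+2},\dots)$, and let $X$ be the inductive limit (increasing union) of the $X_n$. For $f\in F_n$ let $[f]_n\subset X_n\subset X$ be the set of points of $X_n$ with first coordinate $f$. $\mu$ is the $\sigma$-finite Borel measure on $X$ with $\mu([f]_n)=\nu_n(f)$ for all $f\in F_n$, $n\ge0$. For $g\in G$ let $X^g=\bigcup_{n\ge0}\{(f_n,c_{n+1},\dots)\in X_n: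 gf_n\in F_n\}$ and $X^G=\bigcap_{g\in G}X^g$. For $x\in X^G$ set $T_gx=(gf_n,c_{n+1},\dots)\in X_n$, where $n$ is such that $x=(f_n,c_{n+1},\dots)\in X_n$ and $gf_n\in F_n$. Admissibility is equivalent to $\mu(X\setminus X^G)=0$, and then $(X,\mu,T)$ is the nonsingular $(C,F)$-action associated with $\mathcal T$. **Odometers.** For $(\Gamma_n)_n$ as in the claim, the topological $G$-odometer is $Y=\varprojlim G/\Gamma_n$ with $O_g(g_n\Gamma_n)_n=(gg_n\Gamma_n)_n$. A nonsingular odometer is a topological odometer endowed with an $O$-quasi-invariant Borel measure; $T$ has a nonsingular odometer factor if for some such $(\Gamma_n)_n$ there is a measurable a.e. $G$-equivariant map $X\to Y$. *)

theory Defs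
  imports "HOL-Probability.Probability" "HOL-Algebra.Left_Coset"
begin

definition finite_index_subgroup :: "('a, 'b) monoid_scheme \<Rightarrow> 'a set \<Rightarrow> bool" where
  "finite_index_subgroup G H \<longleftrightarrow> subgroup H G \<and> finite (lcosets\<^bsub>G\<^esub> H)"

definition residually_finite :: "('a, 'b) monoid_scheme \<Rightarrow> bool" where
  "residually_finite G \<longleftrightarrow>
     (\<forall>g\<in>carrier G. g \<noteq> \<one>\<^bsub>G\<^esub> \<longrightarrow> (\<exists>N. N \<lhd> G \<and> finite_index_subgroup G N \<and> g \<notin> N))"

definition borel_on :: "'a topology \<Rightarrow> 'a measure" where
  "borel_on T = sigma (topspace T) {U. openin T U}"


text \<open>\<open>set_range_prod G C p q\<close> is $C_{p+1} C_{p+2} \cdots C_q$ and \<open>conv_range G \<kappa> p q\<close> is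
  $\kappa_{p+1} * \cdots * \kappa_q$; for $q \le p$ these are the neutral elements, $\{1_G\}$ and
  the point mass at $1_G$.\<close>

definition conv_pmf :: "('a, 'b) monoid_scheme \<Rightarrow> 'a pmf \<Rightarrow> 'a pmf \<Rightarrow> 'a pmf" where
  "conv_pmf G p q = map_pmf (\<lambda>(a, b). a \<otimes>\<^bsub>G\<^esub> b) (pair_pmf p q)"

definition conv_range :: "('a, 'b) monoid_scheme \<Rightarrow> (nat \<Rightarrow> 'a pmf) \<Rightarrow> nat \<Rightarrow> nat \<Rightarrow> 'a pmf" where
  "conv_range G \<kappa> p q = foldr (conv_pmf G) (map \<kappa> [Suc p..<Suc q]) (return_pmf \<one>\<^bsub>G\<^esub>)"

definition set_range_prod :: "('a, 'b) monoid_scheme \<Rightarrow> (nat \<Rightarrow> 'a set) \<Rightarrow> nat \<Rightarrow> nat \<Rightarrow> 'a set" where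
  "set_range_prod G C p q = foldr (set_mult G) (map C [Suc p..<Suc q]) {\<one>\<^bsub>G\<^esub>}"


text \<open>The families \<open>C\<close> and \<open>\<kappa>\<close> are indexed by $n \ge 1$; their values at \<open>0\<close> are never used.
  That \<open>\<kappa> n\<close> is a probability on \<open>C n\<close> with full support is \<open>set_pmf (\<kappa> n) = C n\<close>.\<close>

locale CF_parameters = group G for G :: "('a, 'b) monoid_scheme" (structure) +
  fixes C F :: "nat \<Rightarrow> 'a set" and \<kappa> :: "nat \<Rightarrow> 'a pmf" and \<nu> :: "nat \<Rightarrow> 'a measure"
  assumes C_finite: "n \<ge> 1 \<Longrightarrow> finite (C n)"
    and C_subset: "n \<ge> 1 \<Longrightarrow> C n \<subseteq> carrier G"
    and F_finite: "finite (F n)"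
    and F_subset: "F n \<subseteq> carrier G"
    and F_0: "F 0 = {\<one>}"
    and one_mem: "n \<ge> 1 \<Longrightarrow> \<one> \<in> F n \<inter> C n"
    and card_C: "n \<ge> 1 \<Longrightarrow> card (C n) > 1"
    and FC_subset: "F n <#> C (Suc n) \<subseteq> F (Suc n)"
    and FC_disjoint: "c \<in> C (Suc n) \<Longrightarrow> c' \<in> C (Suc n) \<Longrightarrow> c \<noteq> c' \<Longrightarrow> (F n #> c) \<inter> (F n #> c') = {}"
    and \<kappa>_support: "n \<ge> 1 \<Longrightarrow> set_pmf (\<kappa> n) = C n"
    and \<kappa>_nonatomic: "(\<lambda>N. \<Prod>n=1..N. Max (pmf (\<kappa> n) ` C n)) \<longlonglongrightarrow> 0"
    and \<nu>_space: "space (\<nu> n) = F n"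
    and \<nu>_sets: "sets (\<nu> n) = Pow (F n)"
    and \<nu>_finite: "finite_measure (\<nu> n)"
    and \<nu>_support: "f \<in> F n \<Longrightarrow> measure (\<nu> n) {f} > 0"
    and \<nu>_0: "measure (\<nu> 0) {\<one>} = 1"
    and \<nu>_Suc: "f \<in> F n \<Longrightarrow> c \<in> C (Suc n) \<Longrightarrow>
        measure (\<nu> (Suc n)) {f \<otimes> c} = measure (\<nu> n) {f} * pmf (\<kappa> (Suc n)) c"

definition CF_admissible ::
  "('a, 'b) monoid_scheme \<Rightarrow> (nat \<Rightarrow> 'a set) \<Rightarrow> (nat \<Rightarrow> 'a set) \<Rightarrow> (nat \<Rightarrow> 'a measure) \<Rightarrow> bool" where
  "CF_admissible G C F \<nu> \<longleftrightarrow> (\<forall>g\<in>carrier G. \<forall>n.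
     (\<lambda>m. measure (\<nu> m)
        ((F n <#>\<^bsub>G\<^esub> set_range_prod G C n m) \<inter> (inv\<^bsub>G\<^esub> g <#\<^bsub>G\<^esub> F m)))
       \<longlonglongrightarrow> measure (\<nu> n) (F n))"


text \<open>A point of \<open>X\<^sub>n\<close> is a sequence \<open>x\<close> with \<open>x 0\<close> the coordinate in \<open>F n\<close> and \<open>x i\<close> the
  coordinate in \<open>C (n + i)\<close> for $i \ge 1$. The inductive limit \<open>X\<close> is the quotient of the disjoint
  union of the \<open>X\<^sub>n\<close> that identifies points having a common image in some later \<open>X\<^sub>N\<close>; as the maps
  \<open>X\<^sub>n \<rightarrow> X\<^sub>n\<^sub>+\<^sub>1\<close> are injective, this is the increasing union of copies of the \<open>X\<^sub>n\<close>.\<close>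

definition CF_level :: "(nat \<Rightarrow> 'a set) \<Rightarrow> (nat \<Rightarrow> 'a set) \<Rightarrow> nat \<Rightarrow> (nat \<Rightarrow> 'a) set" where
  "CF_level C F n = (\<Pi>\<^sub>E i\<in>UNIV. if i = 0 then F n else C (n + i))"

definition CF_level_topology ::
  "(nat \<Rightarrow> 'a set) \<Rightarrow> (nat \<Rightarrow> 'a set) \<Rightarrow> nat \<Rightarrow> (nat \<Rightarrow> 'a) topology" where
  "CF_level_topology C F n =
     product_topology (\<lambda>i. discrete_topology (if i = 0 then F n else C (n + i))) UNIV"

lemma topspace_CF_level_topology: "topspace (CF_level_topology C F n) = CF_level C F n"
  by (simp add: CF_level_topology_def CF_level_def)

definition CF_embed :: "('a, 'b) monoid_scheme \<Rightarrow> (nat \<Rightarrow> 'a) \<Rightarrow> (nat \<Rightarrow> 'a)" where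
  "CF_embed G x = (\<lambda>i. if i = 0 then x 0 \<otimes>\<^bsub>G\<^esub> x 1 else x (Suc i))"

definition CF_rel ::
  "('a, 'b) monoid_scheme \<Rightarrow> (nat \<Rightarrow> 'a set) \<Rightarrow> (nat \<Rightarrow> 'a set) \<Rightarrow>
     ((nat \<times> (nat \<Rightarrow> 'a)) \<times> (nat \<times> (nat \<Rightarrow> 'a))) set" where
  "CF_rel G C F = {((n, x), (m, y)). x \<in> CF_level C F n \<and> y \<in> CF_level C F m \<and>
     (\<exists>k l. n + k = m + l \<and> (CF_embed G ^^ k) x = (CF_embed G ^^ l) y)}"

definition CF_space ::
  "('a, 'b) monoid_scheme \<Rightarrow> (nat \<Rightarrow> 'a set) \<Rightarrow> (nat \<Rightarrow> 'a set) \<Rightarrow>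
     (nat \<times> (nat \<Rightarrow> 'a)) set set" where
  "CF_space G C F = (SIGMA n:UNIV. CF_level C F n) // CF_rel G C F"

text \<open>The canonical map \<open>X\<^sub>n \<rightarrow> X\<close>.\<close>

definition CF_pt ::
  "('a, 'b) monoid_scheme \<Rightarrow> (nat \<Rightarrow> 'a set) \<Rightarrow> (nat \<Rightarrow> 'a set) \<Rightarrow> nat \<Rightarrow> (nat \<Rightarrow> 'a) \<Rightarrow>
     (nat \<times> (nat \<Rightarrow> 'a)) set" where
  "CF_pt G C F n x = CF_rel G C F `` {(n, x)}"

definition CF_open ::
  "('a, 'b) monoid_scheme \<Rightarrow> (nat \<Rightarrow> 'a set) \<Rightarrow> (nat \<Rightarrow> 'a set) \<Rightarrow>
     (nat \<times> (nat \<Rightarrow> 'a)) set set \<Rightarrow> bool" where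
  "CF_open G C F U \<longleftrightarrow> U \<subseteq> CF_space G C F \<and>
     (\<forall>n. openin (CF_level_topology C F n) {x \<in> CF_level C F n. CF_pt G C F n x \<in> U})"

definition CF_topology ::
  "('a, 'b) monoid_scheme \<Rightarrow> (nat \<Rightarrow> 'a set) \<Rightarrow> (nat \<Rightarrow> 'a set) \<Rightarrow>
     (nat \<times> (nat \<Rightarrow> 'a)) set topology" where
  "CF_topology G C F = topology (CF_open G C F)"

lemma istopology_CF_open: "istopology (CF_open G C F)"
proof -
  have inter: "CF_open G C F (S \<inter> T)" if S: "CF_open G C F S" and T: "CF_open G C F T" for S T
  proof -
    have "{x \<in> CF_level C F n. CF_pt G C F n x \<in> S \<inter> T} =
        {x \<in> CF_level C F n. CF_pt G C F n x \<in> S} \<inter> {x \<in> CF_level C F n. CF_pt G C F n x \<in> T}" for n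
      by auto
    then show ?thesis
      using S T unfolding CF_open_def by (metis (no_types, lifting) le_infI1 openin_Int)
  qed
  have union: "CF_open G C F (\<Union>\<K>)" if K: "\<forall>S\<in>\<K>. CF_open G C F S" for \<K>
  proof -
    have "{x \<in> CF_level C F n. CF_pt G C F n x \<in> \<Union>\<K>} =
        (\<Union>S\<in>\<K>. {x \<in> CF_level C F n. CF_pt G C F n x \<in> S})" for n
      by auto
    moreover have "openin (CF_level_topology C F n)
        (\<Union>S\<in>\<K>. {x \<in> CF_level C F n. CF_pt G C F n x \<in> S})" for n
      using K unfolding CF_open_def by (intro openin_Union) auto
    ultimately show ?thesis
      using K unfolding CF_open_def by auto
  qed
  show ?thesis
    unfolding istopology_def using inter union by blast
qed

lemma openin_CF_topology: "openin (CF_topology G C F) U \<longleftrightarrow> CF_open G C F U"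
  by (simp add: CF_topology_def topology_inverse' istopology_CF_open)

lemma topspace_CF_topology: "topspace (CF_topology G C F) = CF_space G C F"
proof -
  have "CF_pt G C F n x \<in> CF_space G C F" if "x \<in> CF_level C F n" for n x
    using that unfolding CF_pt_def CF_space_def by (intro quotientI) auto
  then have "{x \<in> CF_level C F n. CF_pt G C F n x \<in> CF_space G C F} = CF_level C F n" for n
    by auto
  then have "CF_open G C F (CF_space G C F)"
    unfolding CF_open_def
    by (metis openin_topspace order_refl topspace_CF_level_topology)
  then show ?thesis
    by (auto simp: topspace_def openin_CF_topology CF_open_def)
qed

definition CF_cylinder ::
  "('a, 'b) monoid_scheme \<Rightarrow> (nat \<Rightarrow> 'a set) \<Rightarrow> (nat \<Rightarrow> 'a set) \<Rightarrow> nat \<Rightarrow> 'a \<Rightarrow>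
     (nat \<times> (nat \<Rightarrow> 'a)) set set" where
  "CF_cylinder G C F n f = {CF_pt G C F n x | x. x \<in> CF_level C F n \<and> x 0 = f}"

definition is_CF_measure ::
  "('a, 'b) monoid_scheme \<Rightarrow> (nat \<Rightarrow> 'a set) \<Rightarrow> (nat \<Rightarrow> 'a set) \<Rightarrow> (nat \<Rightarrow> 'a measure) \<Rightarrow>
     (nat \<times> (nat \<Rightarrow> 'a)) set measure \<Rightarrow> bool" where
  "is_CF_measure G C F \<nu> \<mu> \<longleftrightarrow>
     sets \<mu> = sets (borel_on (CF_topology G C F)) \<and> sigma_finite_measure \<mu> \<and>
     (\<forall>n. \<forall>f\<in>F n. emeasure \<mu> (CF_cylinder G C F n f) = emeasure (\<nu> n) {f})"

definition CF_dom ::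
  "('a, 'b) monoid_scheme \<Rightarrow> (nat \<Rightarrow> 'a set) \<Rightarrow> (nat \<Rightarrow> 'a set) \<Rightarrow> 'a \<Rightarrow>
     (nat \<times> (nat \<Rightarrow> 'a)) set set" where
  "CF_dom G C F g = {CF_pt G C F n x | n x. x \<in> CF_level C F n \<and> g \<otimes>\<^bsub>G\<^esub> x 0 \<in> F n}"

definition CF_dom_all ::
  "('a, 'b) monoid_scheme \<Rightarrow> (nat \<Rightarrow> 'a set) \<Rightarrow> (nat \<Rightarrow> 'a set) \<Rightarrow>
     (nat \<times> (nat \<Rightarrow> 'a)) set set" where
  "CF_dom_all G C F = (\<Inter>g\<in>carrier G. CF_dom G C F g)"

text \<open>\<open>T\<^sub>g\<close> is meaningful only on \<open>CF_dom G C F g\<close>; the result does not depend on the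
  representative \<open>(n, x)\<close>.\<close>

definition CF_action ::
  "('a, 'b) monoid_scheme \<Rightarrow> (nat \<Rightarrow> 'a set) \<Rightarrow> (nat \<Rightarrow> 'a set) \<Rightarrow> 'a \<Rightarrow>
     (nat \<times> (nat \<Rightarrow> 'a)) set \<Rightarrow> (nat \<times> (nat \<Rightarrow> 'a)) set" where
  "CF_action G C F g p = (THE p'. \<exists>n x. x \<in> CF_level C F n \<and> g \<otimes>\<^bsub>G\<^esub> x 0 \<in> F n \<and>
     p = CF_pt G C F n x \<and> p' = CF_pt G C F n (x(0 := g \<otimes>\<^bsub>G\<^esub> x 0)))"


text \<open>Sequences of subgroups are numbered from \<open>0\<close>: \<open>\<Gamma> n\<close> stands for $\Gamma_{n+1}$.\<close>

definition odometer_sequence :: "('a, 'b) monoid_scheme \<Rightarrow> (nat \<Rightarrow> 'a set) \<Rightarrow> bool" where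
  "odometer_sequence G \<Gamma> \<longleftrightarrow>
     (\<forall>n. finite_index_subgroup G (\<Gamma> n)) \<and> (\<forall>n. \<Gamma> (Suc n) \<subset> \<Gamma> n) \<and>
     (\<Inter>n. \<Inter>g\<in>carrier G. (g <#\<^bsub>G\<^esub> \<Gamma> n) #>\<^bsub>G\<^esub> inv\<^bsub>G\<^esub> g) = {\<one>\<^bsub>G\<^esub>}"

text \<open>The bonding map $G/\Gamma_{n+1} \to G/\Gamma_n$ sends a coset \<open>A\<close> to the product set
  $A\,\Gamma_n$.\<close>

definition odometer_space :: "('a, 'b) monoid_scheme \<Rightarrow> (nat \<Rightarrow> 'a set) \<Rightarrow> (nat \<Rightarrow> 'a set) set" where
  "odometer_space G \<Gamma> =
     {y \<in> (\<Pi>\<^sub>E n\<in>UNIV. lcosets\<^bsub>G\<^esub> \<Gamma> n). \<forall>n. y n = y (Suc n) <#>\<^bsub>G\<^esub> \<Gamma> n}"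

definition odometer_topology ::
  "('a, 'b) monoid_scheme \<Rightarrow> (nat \<Rightarrow> 'a set) \<Rightarrow> (nat \<Rightarrow> 'a set) topology" where
  "odometer_topology G \<Gamma> =
     subtopology (product_topology (\<lambda>n. discrete_topology (lcosets\<^bsub>G\<^esub> \<Gamma> n)) UNIV)
       (odometer_space G \<Gamma>)"

definition odometer_action ::
  "('a, 'b) monoid_scheme \<Rightarrow> 'a \<Rightarrow> (nat \<Rightarrow> 'a set) \<Rightarrow> (nat \<Rightarrow> 'a set)" where
  "odometer_action G g y = (\<lambda>n. g <#\<^bsub>G\<^esub> y n)"

text \<open>For admissible parameters \<open>CF_dom_all\<close> is conull, so the guard below only keeps the
  unspecified values of \<open>CF_action\<close> out of the equivariance condition. No measure on the odometer
  is mentioned: the image under \<open>\<phi>\<close> of a finite measure equivalent to \<open>\<mu>\<close> is a quasi-invariant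
  one.\<close>

definition has_nonsingular_odometer_factor ::
  "('a, 'b) monoid_scheme \<Rightarrow> (nat \<Rightarrow> 'a set) \<Rightarrow> (nat \<Rightarrow> 'a set) \<Rightarrow>
     (nat \<times> (nat \<Rightarrow> 'a)) set measure \<Rightarrow> bool" where
  "has_nonsingular_odometer_factor G C F \<mu> \<longleftrightarrow>
     (\<exists>\<Gamma>. odometer_sequence G \<Gamma> \<and>
       (\<exists>\<phi> \<in> measurable \<mu> (borel_on (odometer_topology G \<Gamma>)).
          \<forall>g\<in>carrier G. AE p in \<mu>. p \<in> CF_dom_all G C F \<longrightarrow>
            \<phi> (CF_action G C F g p) = odometer_action G g (\<phi> p)))"

end

theory Submission
  imports Defs
begin

text \<open>
  Write \<open>p = (f\<^sub>m, c\<^sub>m\<^sub>+\<^sub>1, \<dots>)\<close> for the coordinates of a point at level \<open>m\<close>.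

  If the sum for \<open>\<Gamma>\<close> and \<open>q\<close> is finite, then by Borel--Cantelli the blocks
  $c_{q_n+1} \cdots c_{q_{n+1}}$ of almost every point eventually lie in \<open>\<Gamma> n\<close>. Hence the cosets
  \<open>f\<^sub>m \<Gamma> n\<close>, \<open>m\<close> ranging over the values of \<open>q\<close>, are eventually constant, and their limits form an
  equivariant map to the odometer.

  Conversely, let \<open>\<phi>\<close> be a factor map. Each set $\{\phi_n = A\}$ of positive measure almost fills
  some cylinder of arbitrarily high level \<open>m\<close>, and by equivariance the cylinder can be translated to
  the one with first coordinate \<open>1\<close>. So \<open>\<phi> n\<close> is almost constant on that cylinder, and by
  compactness of the odometer there are levels \<open>q n\<close> and a coherent sequence of cosets \<open>b n\<close> such
  that $\phi_n = b_n$ there up to relative measure $2^{-n}$. A block \<open>c\<close> from level \<open>q n\<close> to level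
  $q_{n+1}$ satisfies $\phi_n(p) = c\,\phi_n(c^{-1} p)$, so it stabilises \<open>b n\<close> unless \<open>p\<close> or
  $c^{-1}p$ is exceptional. The stabilisers of the \<open>b n\<close> are conjugates of the \<open>\<Gamma> n\<close> and form the
  required sequence.
\<close>

section \<open>Borel sets, iterated embeddings and blocks\<close>

lemma sets_borel_on: "sets (borel_on T) = sigma_sets (topspace T) {U. openin T U}"
  unfolding borel_on_def by (rule sets_measure_of) (auto dest: openin_subset)

lemma space_borel_on: "space (borel_on T) = topspace T"
  unfolding borel_on_def by (rule space_measure_of) (auto dest: openin_subset)

text \<open>The first coordinate that \<open>x\<close> acquires after \<open>k\<close> embeddings,
  each of which absorbs one more coordinate into it.\<close>

fun coord_prod :: "('a, 'b) monoid_scheme \<Rightarrow> (nat \<Rightarrow> 'a) \<Rightarrow> nat \<Rightarrow> 'a" where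
  "coord_prod G x 0 = x 0"
| "coord_prod G x (Suc k) = coord_prod G x k \<otimes>\<^bsub>G\<^esub> x (Suc k)"

lemma coord_prod_cong: "(\<And>i. i \<le> k \<Longrightarrow> x i = y i) \<Longrightarrow> coord_prod G x k = coord_prod G y k"
  by (induction k) auto

lemma CF_embed_funpow:
  "(CF_embed G ^^ k) x = (\<lambda>i. if i = 0 then coord_prod G x k else x (i + k))"
proof (induction k)
  case 0
  then show ?case by auto
next
  case (Suc k)
  show ?case by (rule ext)
      (simp add: Suc CF_embed_def[of G "\<lambda>i. if i = 0 then coord_prod G x k else x (i + k)"])
qed

lemma set_range_prod_refl: "set_range_prod G C p p = {\<one>\<^bsub>G\<^esub>}"
  by (simp add: set_range_prod_def)

lemma conv_range_refl: "conv_range G \<kappa> p p = return_pmf \<one>\<^bsub>G\<^esub>"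
  by (simp add: conv_range_def)

text \<open>Since \<open>foldr\<close> associates to the right, a block is peeled at its lower end;
  inductions on blocks therefore vary \<open>p\<close> and keep \<open>q\<close> fixed.\<close>

lemma set_range_prod_step:
  "p < q \<Longrightarrow> set_range_prod G C p q = C (Suc p) <#>\<^bsub>G\<^esub> set_range_prod G C (Suc p) q"
  unfolding set_range_prod_def by (simp add: upt_conv_Cons del: upt_Suc)

lemma conv_range_step:
  "p < q \<Longrightarrow> conv_range G \<kappa> p q = conv_pmf G (\<kappa> (Suc p)) (conv_range G \<kappa> (Suc p) q)"
  unfolding conv_range_def by (simp add: upt_conv_Cons del: upt_Suc)

section \<open>Points, levels and cylinders\<close>

context CF_parameters
begin

abbreviation "lev \<equiv> CF_level C F"
abbreviation "pt \<equiv> CF_pt G C F"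
abbreviation "cyl \<equiv> CF_cylinder G C F"
abbreviation "word \<equiv> set_range_prod G C"
abbreviation "conv \<equiv> conv_range G \<kappa>"
abbreviation "wt n f \<equiv> measure (\<nu> n) {f}"

lemma level_iff: "x \<in> lev n \<longleftrightarrow> x 0 \<in> F n \<and> (\<forall>i\<ge>1. x i \<in> C (n + i))"
  unfolding CF_level_def PiE_def Pi_def by auto

lemma level_C: "x \<in> lev n \<Longrightarrow> i \<ge> 1 \<Longrightarrow> x i \<in> C (n + i)"
  by (simp add: level_iff)

lemma F_closed: "f \<in> F n \<Longrightarrow> f \<in> carrier G"
  using F_subset by blast

lemma C_closed: "c \<in> C (Suc n) \<Longrightarrow> c \<in> carrier G"
  using C_subset[of "Suc n"] by auto

lemma FC_closed: "f \<in> F n \<Longrightarrow> c \<in> C (Suc n) \<Longrightarrow> f \<otimes> c \<in> F (Suc n)"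
  using FC_subset[of n] by (auto simp: set_mult_def)

lemma one_F: "\<one> \<in> F n"
  by (cases n) (use one_mem in \<open>auto simp: F_0\<close>)

text \<open>A common value would lie in both translates \<open>F n #> c\<close> and
  \<open>F n #> c'\<close>, whose disjointness forces \<open>c = c'\<close>; then \<open>c\<close>
  cancels in the group.\<close>

lemma FC_cancel:
  assumes "f \<in> F n" "f' \<in> F n" "c \<in> C (Suc n)" "c' \<in> C (Suc n)" "f \<otimes> c = f' \<otimes> c'"
  shows "f = f' \<and> c = c'"
proof -
  have "f \<otimes> c \<in> F n #> c" "f' \<otimes> c' \<in> F n #> c'"
    using assms(1,2) by (auto simp: r_coset_def)
  then have "c = c'"
    using FC_disjoint[OF assms(3,4)] assms(5) by auto
  then show ?thesis
    using assms F_closed C_closed by (metis right_cancel)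
qed

lemma CF_embed_level: "x \<in> lev n \<Longrightarrow> CF_embed G x \<in> lev (Suc n)"
  using FC_closed[of "x 0" n "x 1"] by (auto simp: level_iff CF_embed_def)

lemma CF_embed_funpow_level: "x \<in> lev n \<Longrightarrow> (CF_embed G ^^ k) x \<in> lev (n + k)"
  by (induction k) (auto intro: CF_embed_level)

text \<open>Only the first two coordinates are merged, and \<open>FC_cancel\<close> separates them
  again; all others are merely shifted.\<close>

lemma CF_embed_inj:
  assumes "x \<in> lev n" "y \<in> lev n" "CF_embed G x = CF_embed G y"
  shows "x = y"
proof
  fix i
  have e: "CF_embed G x j = CF_embed G y j" for j
    using assms by simp
  have "x 0 = y 0 \<and> x 1 = y 1"
    using FC_cancel[of "x 0" n "y 0" "x 1" "y 1"] assms(1,2) e[of 0]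
      level_C[OF assms(1), of 1] level_C[OF assms(2), of 1]
    by (auto simp: level_iff CF_embed_def)
  moreover have "x (Suc j) = y (Suc j)" if "j > 0" for j
    using e[of j] that by (simp add: CF_embed_def)
  ultimately show "x i = y i"
    by (metis One_nat_def gr0I not0_implies_Suc)
qed

lemma CF_embed_funpow_inj:
  "x \<in> lev n \<Longrightarrow> y \<in> lev n \<Longrightarrow> (CF_embed G ^^ k) x = (CF_embed G ^^ k) y \<Longrightarrow> x = y"
  by (induction k) (auto dest: CF_embed_inj[OF CF_embed_funpow_level CF_embed_funpow_level])

lemma equiv_CF_rel: "equiv (SIGMA n:UNIV. lev n) (CF_rel G C F)"
proof (rule equivI)
  show "CF_rel G C F \<subseteq> (SIGMA n:UNIV. lev n) \<times> (SIGMA n:UNIV. lev n)"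
    unfolding CF_rel_def by auto
  show "refl_on (SIGMA n:UNIV. lev n) (CF_rel G C F)"
    unfolding refl_on_def CF_rel_def by auto
  show "sym (CF_rel G C F)"
    unfolding sym_def CF_rel_def by clarsimp metis
  show "trans (CF_rel G C F)"
  proof (rule transI)
    fix u v t
    assume "(u, v) \<in> CF_rel G C F" "(v, t) \<in> CF_rel G C F"
    then obtain n x m y p z k l k' l' where
      uvt: "u = (n, x)" "v = (m, y)" "t = (p, z)" "x \<in> lev n" "y \<in> lev m" "z \<in> lev p"
      and h: "n + k = m + l" "(CF_embed G ^^ k) x = (CF_embed G ^^ l) y"
        "m + k' = p + l'" "(CF_embed G ^^ k') y = (CF_embed G ^^ l') z"
      unfolding CF_rel_def by auto
    have cm: "(CF_embed G ^^ a) ((CF_embed G ^^ b) u) = (CF_embed G ^^ (a + b)) u" for a b u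
      by (simp add: funpow_add)
    \<comment> \<open>Iterates commute, so \<open>k'\<close> further embeddings of \<open>x\<close>
      and \<open>l\<close> further embeddings of \<open>z\<close> both reach the
      \<open>(l + k')\<close>-fold embedding of \<open>y\<close>.\<close>
    have "(CF_embed G ^^ (k + k')) x = (CF_embed G ^^ (l + l')) z"
      using h(2,4) cm by (metis add.commute)
    moreover have "n + (k + k') = p + (l + l')"
      using h by simp
    ultimately show "(u, t) \<in> CF_rel G C F"
      unfolding CF_rel_def using uvt by auto
  qed
qed

lemma pt_eq_iff:
  assumes "x \<in> lev n" "y \<in> lev m"
  shows "pt n x = pt m y \<longleftrightarrow> (\<exists>k l. n + k = m + l \<and> (CF_embed G ^^ k) x = (CF_embed G ^^ l) y)"
proof -
  have "pt n x = pt m y \<longleftrightarrow> ((n, x), (m, y)) \<in> CF_rel G C F"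
    unfolding CF_pt_def using eq_equiv_class_iff[OF equiv_CF_rel] assms by auto
  then show ?thesis
    unfolding CF_rel_def using assms by auto
qed

text \<open>At equal levels the two exponents in \<open>pt_eq_iff\<close> coincide, so injectivity
  of the iterated embedding applies.\<close>

lemma pt_inj: "x \<in> lev n \<Longrightarrow> y \<in> lev n \<Longrightarrow> pt n x = pt n y \<Longrightarrow> x = y"
  by (auto simp: pt_eq_iff dest: CF_embed_funpow_inj)

lemma pt_funpow: "x \<in> lev n \<Longrightarrow> pt (n + k) ((CF_embed G ^^ k) x) = pt n x"
  by (subst pt_eq_iff, erule CF_embed_funpow_level, assumption, rule exI[of _ 0], rule exI[of _ k]) simp

lemma pt_embed: "x \<in> lev n \<Longrightarrow> pt (Suc n) (CF_embed G x) = pt n x"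
  using pt_funpow[of x n 1] by simp

lemma pt_in_cyl: "x \<in> lev n \<Longrightarrow> pt n x \<in> cyl n (x 0)"
  unfolding CF_cylinder_def by auto

lemma CF_space_eq_pt: "CF_space G C F = {pt n x | n x. x \<in> lev n}"
  unfolding CF_space_def quotient_def CF_pt_def by auto

lemma cyl_disjoint: "f \<noteq> f' \<Longrightarrow> cyl n f \<inter> cyl n f' = {}"
  unfolding CF_cylinder_def by (auto dest: pt_inj)

lemma cyl_nonmem: "f \<notin> F n \<Longrightarrow> cyl n f = {}"
  unfolding CF_cylinder_def by (auto simp: level_iff)

lemma CF_space_eq_cyl: "CF_space G C F = (\<Union>n. \<Union>f\<in>F n. cyl n f)"
  unfolding CF_space_eq_pt CF_cylinder_def by (auto simp: level_iff)

lemma CF_dom_eq_cyl: "CF_dom G C F g = (\<Union>n. \<Union>f\<in>{f \<in> F n. g \<otimes> f \<in> F n}. cyl n f)"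
  unfolding CF_dom_def CF_cylinder_def by (auto simp: level_iff)

text \<open>Cylinders form a tree: the children of \<open>f\<close> at the next level are the
  products \<open>f \<otimes> c\<close>, one for each value of the next coordinate.\<close>

lemma cyl_Suc:
  assumes f: "f \<in> F n"
  shows "cyl n f = (\<Union>c\<in>C (Suc n). cyl (Suc n) (f \<otimes> c))"
proof (intro equalityI subsetI)
  fix p
  assume "p \<in> cyl n f"
  then obtain x where x: "x \<in> lev n" "x 0 = f" "p = pt n x"
    unfolding CF_cylinder_def by auto
  have "p \<in> cyl (Suc n) (f \<otimes> x 1)"
    using pt_in_cyl[OF CF_embed_level[OF x(1)]] x pt_embed[OF x(1)] by (simp add: CF_embed_def)
  moreover have "x 1 \<in> C (Suc n)"
    using x by (auto simp: level_iff)
  ultimately show "p \<in> (\<Union>c\<in>C (Suc n). cyl (Suc n) (f \<otimes> c))"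
    by auto
next
  fix p
  assume "p \<in> (\<Union>c\<in>C (Suc n). cyl (Suc n) (f \<otimes> c))"
  then obtain c z where z: "c \<in> C (Suc n)" "z \<in> lev (Suc n)" "z 0 = f \<otimes> c" "p = pt (Suc n) z"
    unfolding CF_cylinder_def by auto
  \<comment> \<open>The preimage of \<open>z\<close> under the embedding: its first coordinate is
    split into \<open>f\<close> and \<open>c\<close>, and the remaining ones move up by one
    place.\<close>
  define y where "y = (\<lambda>i. if i = 0 then f else if i = 1 then c else z (i - 1))"
  have "z (i - 1) \<in> C (n + i)" if "i > 1" for i
  proof -
    have "Suc n + (i - 1) = n + i" "i - 1 \<ge> 1" using that by auto
    then show ?thesis using z(2) unfolding level_iff by metis
  qed
  then have y: "y \<in> lev n"
    using z(1) f by (auto simp: level_iff y_def)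
  have "CF_embed G y = z"
    using z by (auto simp: CF_embed_def y_def fun_eq_iff)
  then show "p \<in> cyl n f"
    using pt_embed[OF y] pt_in_cyl[OF y] z by (simp add: y_def)
qed

subsection \<open>Blocks of the parameters\<close>

lemma word_Suc_elim:
  assumes "p < q" "d \<in> word p q"
  obtains c d' where "c \<in> C (Suc p)" "d' \<in> word (Suc p) q" "d = c \<otimes> d'"
  using assms by (auto simp: set_range_prod_step set_mult_def)

lemma word_closed: "d \<in> word p q \<Longrightarrow> d \<in> carrier G"
proof (induction "q - p" arbitrary: p d)
  case 0
  then show ?case by (simp add: set_range_prod_def)
next
  case (Suc k)
  then have pq: "p < q" by simp
  from word_Suc_elim[OF pq Suc.prems] obtain c d' where
    "c \<in> C (Suc p)" "d' \<in> word (Suc p) q" "d = c \<otimes> d'" .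
  moreover from Suc.hyps(2) have "k = q - Suc p" by simp
  ultimately show ?case
    using Suc.hyps(1)[of "Suc p" d'] C_closed by simp
qed

text \<open>The convolution is the law of the block of coordinates between levels \<open>p\<close> and \<open>q\<close>.\<close>

lemma word_properties:
  assumes "p \<le> q"
  shows "finite (word p q)"
    and "f \<in> F p \<Longrightarrow> d \<in> word p q \<Longrightarrow> f \<otimes> d \<in> F q"
    and "f \<in> F p \<Longrightarrow> f' \<in> F p \<Longrightarrow> d \<in> word p q \<Longrightarrow> d' \<in> word p q \<Longrightarrow>
      f \<otimes> d = f' \<otimes> d' \<Longrightarrow> f = f' \<and> d = d'"
    and "f \<in> F p \<Longrightarrow> cyl p f = (\<Union>d\<in>word p q. cyl q (f \<otimes> d))"
    and "set_pmf (conv p q) = word p q"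
    and "f \<in> F p \<Longrightarrow> d \<in> word p q \<Longrightarrow> wt q (f \<otimes> d) = wt p f * pmf (conv p q) d"
proof -
  \<comment> \<open>All six claims go through one downward induction on \<open>p\<close>, because
    they feed each other: cancellation for the shorter block gives cancellation for the longer one,
    which in turn gives the weight formula.\<close>
  have "finite (word p q) \<and> (\<forall>f\<in>F p. \<forall>d\<in>word p q. f \<otimes> d \<in> F q) \<and>
    (\<forall>f\<in>F p. \<forall>f'\<in>F p. \<forall>d\<in>word p q. \<forall>d'\<in>word p q. f \<otimes> d = f' \<otimes> d' \<longrightarrow> f = f' \<and> d = d') \<and>
    (\<forall>f\<in>F p. cyl p f = (\<Union>d\<in>word p q. cyl q (f \<otimes> d))) \<and>
    set_pmf (conv p q) = word p q \<and>
    (\<forall>f\<in>F p. \<forall>d\<in>word p q. wt q (f \<otimes> d) = wt p f * pmf (conv p q) d)"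
    using assms
  proof (induction p rule: inc_induct)
    case base
    show ?case by (auto simp: set_range_prod_refl conv_range_refl F_closed)
  next
    case (step p)
    let ?D = "word (Suc p) q"
    have pq: "p < q" using step by simp
    note W = set_range_prod_step[OF pq, of G C]
    have D: "d \<in> carrier G" if "d \<in> ?D" for d
      using word_closed that .
    have as: "f \<otimes> (c \<otimes> d) = f \<otimes> c \<otimes> d" if "f \<in> F p" "c \<in> C (Suc p)" "d \<in> ?D" for f c d
      using that by (simp add: m_assoc F_closed C_closed D)
    have 1: "finite (word p q)"
      using step C_finite[of "Suc p"] by (auto simp: W set_mult_def)
    have 2: "\<forall>f\<in>F p. \<forall>d\<in>word p q. f \<otimes> d \<in> F q"
      using step FC_closed by (auto simp: W set_mult_def as)
    have 3: "f = f' \<and> c = c' \<and> d = d'"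
      if h: "f \<in> F p" "f' \<in> F p" "c \<in> C (Suc p)" "c' \<in> C (Suc p)" "d \<in> ?D" "d' \<in> ?D"
        "f \<otimes> (c \<otimes> d) = f' \<otimes> (c' \<otimes> d')" for f f' c c' d d'
    proof -
      have "f \<otimes> c \<otimes> d = f' \<otimes> c' \<otimes> d'"
        using h by (simp add: as)
      then have "f \<otimes> c = f' \<otimes> c' \<and> d = d'"
        using step.IH[THEN conjunct2, THEN conjunct2, THEN conjunct1, rule_format]
          FC_closed[OF h(1,3)] FC_closed[OF h(2,4)] h(5,6) by simp
      then show ?thesis
        using FC_cancel h by blast
    qed
    have 4: "\<forall>f\<in>F p. cyl p f = (\<Union>d\<in>word p q. cyl q (f \<otimes> d))"
    proof
      fix f assume f: "f \<in> F p"
      have "cyl p f = (\<Union>c\<in>C (Suc p). \<Union>d\<in>?D. cyl q (f \<otimes> c \<otimes> d))"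
        using step FC_closed f by (simp add: cyl_Suc)
      then show "cyl p f = (\<Union>d\<in>word p q. cyl q (f \<otimes> d))"
        using f by (auto simp: W set_mult_def as)
    qed
    have S: "set_pmf (\<kappa> (Suc p)) = C (Suc p)"
      by (simp add: \<kappa>_support)
    have 5: "set_pmf (conv p q) = word p q"
      using step by (auto simp: conv_range_step[OF pq] conv_pmf_def W set_mult_def S)
    have 6: "wt q (f \<otimes> d) = wt p f * pmf (conv p q) d" if f: "f \<in> F p" and d: "d \<in> word p q" for f d
    proof -
      from word_Suc_elim[OF pq d] obtain c d' where
        cd: "c \<in> C (Suc p)" "d' \<in> word (Suc p) q" "d = c \<otimes> d'" .
      \<comment> \<open>A convolution sums over all factorisations of \<open>d\<close>. Unique
        factorisation on the support leaves a single summand, so the mass of \<open>d\<close> is a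
        product.\<close>
      have "inj_on (\<lambda>(a, b). a \<otimes> b) (set_pmf (pair_pmf (\<kappa> (Suc p)) (conv (Suc p) q)))"
      proof -
        have "inj_on (\<lambda>(a, b). a \<otimes> b) (C (Suc p) \<times> ?D)"
          using 3[OF f f] by (auto simp: inj_on_def)
        then show ?thesis
          using step S by auto
      qed
      from pmf_map_inj[OF this, of "(c, d')"]
      have "pmf (conv p q) d = pmf (\<kappa> (Suc p)) c * pmf (conv (Suc p) q) d'"
        using step S cd by (simp add: conv_range_step[OF pq] conv_pmf_def pmf_pair)
      then show ?thesis
        using step cd f FC_closed \<nu>_Suc[OF f cd(1)] by (simp add: as)
    qed
    have 7: "f = f' \<and> d = d'"
      if h: "f \<in> F p" "f' \<in> F p" "d \<in> word p q" "d' \<in> word p q" "f \<otimes> d = f' \<otimes> d'" for f f' d d'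
      using word_Suc_elim[OF pq h(3)] word_Suc_elim[OF pq h(4)] 3[OF h(1,2)] h(5) by metis
    show ?case
      by (intro conjI ballI impI 1 2[rule_format] 4[rule_format] 5 6)
         (use 7 in blast)+
  qed
  then show "finite (word p q)"
    and "f \<in> F p \<Longrightarrow> d \<in> word p q \<Longrightarrow> f \<otimes> d \<in> F q"
    and "f \<in> F p \<Longrightarrow> f' \<in> F p \<Longrightarrow> d \<in> word p q \<Longrightarrow> d' \<in> word p q \<Longrightarrow>
      f \<otimes> d = f' \<otimes> d' \<Longrightarrow> f = f' \<and> d = d'"
    and "f \<in> F p \<Longrightarrow> cyl p f = (\<Union>d\<in>word p q. cyl q (f \<otimes> d))"
    and "set_pmf (conv p q) = word p q"
    and "f \<in> F p \<Longrightarrow> d \<in> word p q \<Longrightarrow> wt q (f \<otimes> d) = wt p f * pmf (conv p q) d"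
    by auto
qed

lemmas finite_word = word_properties(1)
  and F_word_closed = word_properties(2)
  and F_word_cancel = word_properties(3)
  and cyl_split = word_properties(4)
  and wt_word = word_properties(6)

lemma word_in_F: "p \<le> q \<Longrightarrow> d \<in> word p q \<Longrightarrow> d \<in> F q"
  using F_word_closed[OF _ one_F] word_closed by force

lemma wt_pos: "f \<in> F n \<Longrightarrow> wt n f > 0"
  by (rule \<nu>_support)

subsection \<open>The topology\<close>

lemma cyl_subset_space: "cyl n f \<subseteq> CF_space G C F"
  unfolding CF_cylinder_def CF_space_eq_pt by auto

text \<open>The factors are discrete, so the sets that fix finitely many initial coordinates form a
  neighbourhood base of the product.\<close>

lemma openin_lev_iff:
  assumes "S \<subseteq> lev n"
  shows "openin (CF_level_topology C F n) S \<longleftrightarrow>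
    (\<forall>x\<in>S. \<exists>k. \<forall>y\<in>lev n. (\<forall>i\<le>k. y i = x i) \<longrightarrow> y \<in> S)" (is "?L \<longleftrightarrow> ?R")
proof
  let ?T = "\<lambda>i. if i = 0 then F n else C (n + i)"
  assume L: ?L
  show ?R
  proof
    fix x assume x: "x \<in> S"
    obtain U where U: "x \<in> Pi\<^sub>E UNIV U" "finite {i. U i \<noteq> ?T i}" "Pi\<^sub>E UNIV U \<subseteq> S"
      using product_topology_open_contains_basis[OF L[unfolded CF_level_topology_def] x] by auto
    obtain k where k: "\<forall>i\<in>{i. U i \<noteq> ?T i}. i \<le> k"
      using U(2) finite_nat_set_iff_bounded_le by blast
    have "y \<in> S" if y: "y \<in> lev n" "\<forall>i\<le>k. y i = x i" for y
    proof -
      have "y i \<in> U i" for i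
      proof (cases "i \<le> k")
        case True
        then show ?thesis using y U(1) by (auto simp: PiE_def Pi_def)
      next
        case False
        then have "U i = ?T i" using k by blast
        moreover have "y i \<in> ?T i" using y(1) by (auto simp: level_iff)
        ultimately show ?thesis by simp
      qed
      then show ?thesis using U(3) by auto
    qed
    then show "\<exists>k. \<forall>y\<in>lev n. (\<forall>i\<le>k. y i = x i) \<longrightarrow> y \<in> S" by auto
  qed
next
  let ?T = "\<lambda>i. if i = 0 then F n else C (n + i)"
  assume R: ?R
  show ?L
    unfolding CF_level_topology_def openin_product_topology_alt
  proof
    fix x assume x: "x \<in> S"
    then obtain k where k: "\<forall>y\<in>lev n. (\<forall>i\<le>k. y i = x i) \<longrightarrow> y \<in> S"
      using R by auto
    define U where "U = (\<lambda>i. if i \<le> k then {x i} else ?T i)"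
    have xl: "x \<in> lev n" using x assms by auto
    have xT: "x i \<in> ?T i" for i
      using xl by (auto simp: level_iff)
    have "{i \<in> UNIV. U i \<noteq> topspace (discrete_topology (?T i))} \<subseteq> {..k}"
      unfolding U_def by auto
    then have "finite {i \<in> UNIV. U i \<noteq> topspace (discrete_topology (?T i))}"
      by (rule finite_subset) simp
    moreover have UT: "U i \<subseteq> ?T i" for i
      using xT[of i] by (auto simp: U_def)
    moreover have "x i \<in> U i" for i
      using xT[of i] by (auto simp: U_def)
    then have "x \<in> Pi\<^sub>E UNIV U" by auto
    moreover have "Pi\<^sub>E UNIV U \<subseteq> S"
    proof
      fix y assume y: "y \<in> Pi\<^sub>E UNIV U"
      then have yi: "y i \<in> U i" for i by auto
      then have "y \<in> lev n"
        using UT unfolding CF_level_def by (metis (no_types, lifting) PiE_UNIV_domain UNIV_I Pi_I subsetD)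
      moreover have "\<forall>i\<le>k. y i = x i"
        using yi by (auto simp: U_def split: if_splits) (metis singletonD)
      ultimately show "y \<in> S" using k by auto
    qed
    ultimately show "\<exists>U. finite {i \<in> UNIV. U i \<noteq> topspace (discrete_topology (?T i))} \<and>
        (\<forall>i\<in>UNIV. openin (discrete_topology (?T i)) (U i)) \<and> x \<in> Pi\<^sub>E UNIV U \<and> Pi\<^sub>E UNIV U \<subseteq> S"
      by (intro exI[of _ U]) auto
  qed
qed

text \<open>Membership of \<open>pt n x\<close> in a cylinder is witnessed at a common level after
  finitely many embeddings, hence depends on finitely many coordinates of \<open>x\<close>.\<close>

lemma openin_cyl: "openin (CF_topology G C F) (cyl m f)"
  unfolding openin_CF_topology CF_open_def
proof (intro conjI allI)
  show "cyl m f \<subseteq> CF_space G C F" by (rule cyl_subset_space)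
  fix n
  show "openin (CF_level_topology C F n) {x \<in> lev n. pt n x \<in> cyl m f}"
  proof (subst openin_lev_iff, blast, intro ballI)
    fix x assume x: "x \<in> {x \<in> lev n. pt n x \<in> cyl m f}"
    then obtain y where y: "y \<in> lev m" "y 0 = f" "pt n x = pt m y"
      unfolding CF_cylinder_def by auto
    then obtain k l where kl: "n + k = m + l" "(CF_embed G ^^ k) x = (CF_embed G ^^ l) y"
      using x pt_eq_iff by blast
    have "pt n x' \<in> cyl m f" if x': "x' \<in> lev n" "\<forall>i\<le>k. x' i = x i" for x'
    proof -
      \<comment> \<open>The head of \<open>y\<close> is glued to the tail of \<open>x'\<close>. The
        shift \<open>i - l + k\<close> matches absolute positions because
        \<open>n + k = m + l\<close>, and both sequences then embed to the same point.\<close>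
      define y' where "y' = (\<lambda>i. if i \<le> l then y i else x' (i - l + k))"
      have "x' (i - l + k) \<in> C (m + i)" if "\<not> i \<le> l" for i
      proof -
        have "n + (i - l + k) = m + i" using that kl by simp
        moreover have "i - l + k \<ge> 1" using that by simp
        ultimately show ?thesis using x'(1) unfolding level_iff by metis
      qed
      then have y': "y' \<in> lev m"
        using y(1) by (auto simp: level_iff y'_def)
      have c1: "coord_prod G x' k = coord_prod G x k"
        by (rule coord_prod_cong) (use x' in auto)
      have c2: "coord_prod G y' l = coord_prod G y l"
        by (rule coord_prod_cong) (auto simp: y'_def)
      have c3: "coord_prod G x k = coord_prod G y l"
        using fun_cong[OF kl(2), of 0] by (simp add: CF_embed_funpow)
      have "(CF_embed G ^^ k) x' = (CF_embed G ^^ l) y'"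
        unfolding CF_embed_funpow using c1 c2 c3 by (auto simp: y'_def fun_eq_iff)
      then have "pt n x' = pt m y'"
        using pt_eq_iff[OF x'(1) y'] kl(1) by blast
      then show ?thesis
        using pt_in_cyl[OF y'] y(2) by (simp add: y'_def)
    qed
    then show "\<exists>k. \<forall>y\<in>lev n. (\<forall>i\<le>k. y i = x i) \<longrightarrow> y \<in> {x \<in> lev n. pt n x \<in> cyl m f}"
      by blast
  qed
qed

text \<open>Unique factorisation aside, a level \<open>n + k\<close> cylinder can be read back at
  level \<open>n\<close>: its points arise by keeping the coordinates of \<open>x\<close> up to
  \<open>k\<close> and changing the tail. This turns basic open sets of a level into
  cylinders.\<close>

lemma cyl_coord_prod_subset:
  assumes x: "x \<in> lev n" and p: "p \<in> cyl (n + k) (coord_prod G x k)"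
  obtains y where "y \<in> lev n" "\<forall>i\<le>k. y i = x i" "p = pt n y"
proof -
  obtain z where z: "z \<in> lev (n + k)" "z 0 = coord_prod G x k" "p = pt (n + k) z"
    using p unfolding CF_cylinder_def by auto
  define y where "y = (\<lambda>i. if i \<le> k then x i else z (i - k))"
  have "z (i - k) \<in> C (n + i)" if "\<not> i \<le> k" for i
  proof -
    have "n + k + (i - k) = n + i" "i - k \<ge> 1" using that by auto
    then show ?thesis using z(1) unfolding level_iff by metis
  qed
  then have y: "y \<in> lev n"
    using x by (auto simp: level_iff y_def)
  have "coord_prod G y k = coord_prod G x k"
    by (rule coord_prod_cong) (auto simp: y_def)
  then have "(CF_embed G ^^ k) y = z"
    unfolding CF_embed_funpow using z(2) by (auto simp: y_def fun_eq_iff)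
  then have "p = pt n y"
    using pt_funpow[OF y] z(3) by metis
  then show ?thesis
    using that y by (auto simp: y_def)
qed

text \<open>Cylinders form a base: a neighbourhood of a point at level \<open>n\<close> that is
  determined by the coordinates up to \<open>k\<close> contains the level \<open>n + k\<close>
  cylinder of that point.\<close>

lemma openin_union_cyl:
  assumes "openin (CF_topology G C F) U"
  shows "U = \<Union>{cyl n f | n f. f \<in> F n \<and> cyl n f \<subseteq> U}"
proof (intro equalityI subsetI)
  fix p assume p: "p \<in> U"
  have U: "U \<subseteq> CF_space G C F" "\<And>n. openin (CF_level_topology C F n) {x \<in> lev n. pt n x \<in> U}"
    using assms unfolding openin_CF_topology CF_open_def by auto
  obtain n x where x: "x \<in> lev n" "p = pt n x"
    using p U(1) unfolding CF_space_eq_pt by auto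
  have "\<exists>k. \<forall>y\<in>lev n. (\<forall>i\<le>k. y i = x i) \<longrightarrow> y \<in> {x \<in> lev n. pt n x \<in> U}"
    using U(2)[of n] by (subst (asm) openin_lev_iff) (use x p in auto)
  then obtain k where k: "\<And>y. y \<in> lev n \<Longrightarrow> \<forall>i\<le>k. y i = x i \<Longrightarrow> pt n y \<in> U"
    by auto
  have "cyl (n + k) (coord_prod G x k) \<subseteq> U"
    by (auto elim!: cyl_coord_prod_subset[OF x(1)] intro: k)
  moreover have c: "(CF_embed G ^^ k) x 0 = coord_prod G x k"
    by (simp add: CF_embed_funpow)
  moreover have "p \<in> cyl (n + k) (coord_prod G x k)"
    using pt_in_cyl[OF CF_embed_funpow_level[OF x(1), of k]] c x pt_funpow by simp
  moreover have "coord_prod G x k \<in> F (n + k)"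
    using CF_embed_funpow_level[OF x(1), of k] c by (simp add: level_iff)
  ultimately show "p \<in> \<Union>{cyl n f | n f. f \<in> F n \<and> cyl n f \<subseteq> U}"
    by blast
qed auto

section \<open>Cylinders as a countable generator of the Borel sets\<close>

definition cyls :: "(nat \<times> (nat \<Rightarrow> 'a)) set set set" where
  "cyls = {cyl n f | n f. f \<in> F n}"

lemma countable_cyls: "countable cyls"
proof -
  have "cyls = (\<Union>n. cyl n ` F n)" unfolding cyls_def by auto
  then show ?thesis
    by (simp add: F_finite countable_finite)
qed

lemma cyls_subset: "cyls \<subseteq> Pow (CF_space G C F)"
  unfolding cyls_def using cyl_subset_space by auto

lemma sets_CF_borel:
  "sets (borel_on (CF_topology G C F)) = sigma_sets (CF_space G C F) cyls"
  unfolding sets_borel_on topspace_CF_topology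
proof (rule sigma_sets_eqI)
  fix U assume "U \<in> {U. openin (CF_topology G C F) U}"
  then have "U = \<Union>{cyl n f | n f. f \<in> F n \<and> cyl n f \<subseteq> U}"
    using openin_union_cyl by auto
  moreover have "{cyl n f | n f. f \<in> F n \<and> cyl n f \<subseteq> U} \<subseteq> cyls"
    unfolding cyls_def by auto
  ultimately show "U \<in> sigma_sets (CF_space G C F) cyls"
    by (metis (no_types, lifting) countable_cyls countable_subset sigma_sets.Basic sigma_sets_UNION subset_iff)
next
  fix U assume "U \<in> cyls"
  then show "U \<in> sigma_sets (CF_space G C F) {U. openin (CF_topology G C F) U}"
    unfolding cyls_def using openin_cyl by (auto intro: sigma_sets.Basic)
qed

text \<open>The deeper cylinder is either one of the pieces into which \<open>cyl_split\<close>
  divides the shallower one, or disjoint from all of them.\<close>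

lemma cyl_nested:
  assumes "n \<le> m" "f \<in> F n" "h \<in> F m"
  shows "cyl m h \<subseteq> cyl n f \<or> cyl m h \<inter> cyl n f = {}"
proof (cases "\<exists>d\<in>word n m. h = f \<otimes> d")
  case True
  then show ?thesis
    unfolding cyl_split[OF assms(1,2)] by blast
next
  case False
  then have "cyl m h \<inter> cyl m (f \<otimes> d) = {}" if "d \<in> word n m" for d
    using that cyl_disjoint by metis
  then show ?thesis
    unfolding cyl_split[OF assms(1,2)] by blast
qed

text \<open>By nestedness two cylinders meet in the deeper one or not at all; adding the empty set
  makes a pi-system, as needed for uniqueness of measures.\<close>

lemma Int_stable_cyls: "Int_stable (insert {} cyls)"
proof (rule Int_stableI)
  have *: "cyl n f \<inter> cyl m h \<in> insert {} cyls" if "f \<in> F n" "h \<in> F m" "n \<le> m" for n f m h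
  proof -
    have "cyl n f \<inter> cyl m h = cyl m h \<or> cyl n f \<inter> cyl m h = {}"
      using cyl_nested[OF that(3,1,2)] by blast
    moreover have "cyl m h \<in> cyls"
      using that unfolding cyls_def by blast
    ultimately show ?thesis by (metis insertCI)
  qed
  fix a b assume ab: "a \<in> insert {} cyls" "b \<in> insert {} cyls"
  show "a \<inter> b \<in> insert {} cyls"
  proof (cases "a = {} \<or> b = {}")
    case False
    then obtain n f m h where "a = cyl n f" "b = cyl m h" "f \<in> F n" "h \<in> F m"
      using ab unfolding cyls_def by blast
    then show ?thesis
      using *[of f n h m] *[of h m f n] by (cases "n \<le> m") (auto simp: Int_commute)
  qed auto
qed

subsection \<open>The action\<close>

text \<open>This is well-definedness of the action: left multiplication of the first coordinate
  commutes with the embeddings, which multiply it on the right. Equivalent representatives thus stay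
  equivalent.\<close>

lemma CF_action_pt:
  assumes x: "x \<in> lev n" and g: "g \<in> carrier G" and gx: "g \<otimes> x 0 \<in> F n"
  shows "CF_action G C F g (pt n x) = pt n (x(0 := g \<otimes> x 0))"
  unfolding CF_action_def
proof (rule the_equality)
  show "\<exists>n' x'. x' \<in> lev n' \<and> g \<otimes> x' 0 \<in> F n' \<and> pt n x = pt n' x' \<and>
      pt n (x(0 := g \<otimes> x 0)) = pt n' (x'(0 := g \<otimes> x' 0))"
    using x gx by blast
next
  have tr: "(CF_embed G ^^ k) (z(0 := g \<otimes> z 0)) =
      ((CF_embed G ^^ k) z)(0 := g \<otimes> (CF_embed G ^^ k) z 0)" if z: "z \<in> lev m" for k z m
  proof -
    have cl: "coord_prod G z j \<in> carrier G" for j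
      using CF_embed_funpow_level[OF z, of j] F_closed
      by (auto simp: level_iff CF_embed_funpow)
    have "z (Suc j) \<in> carrier G" for j
      using level_C[OF z, of "Suc j"] C_closed[of "z (Suc j)" "m + j"] by simp
    then have "coord_prod G (z(0 := g \<otimes> z 0)) k = g \<otimes> coord_prod G z k"
      using cl g by (induction k) (auto simp: m_assoc)
    then show ?thesis
      by (auto simp: CF_embed_funpow fun_eq_iff)
  qed
  have lv: "z(0 := g \<otimes> z 0) \<in> lev m" if "z \<in> lev m" "g \<otimes> z 0 \<in> F m" for z m
    using that by (auto simp: level_iff)
  fix p' assume "\<exists>n' x'. x' \<in> lev n' \<and> g \<otimes> x' 0 \<in> F n' \<and> pt n x = pt n' x' \<and>
      p' = pt n' (x'(0 := g \<otimes> x' 0))"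
  then obtain m y where y: "y \<in> lev m" "g \<otimes> y 0 \<in> F m" "pt n x = pt m y"
    "p' = pt m (y(0 := g \<otimes> y 0))" by auto
  then obtain k l where kl: "n + k = m + l" "(CF_embed G ^^ k) x = (CF_embed G ^^ l) y"
    using pt_eq_iff x by blast
  then have "(CF_embed G ^^ k) (x(0 := g \<otimes> x 0)) = (CF_embed G ^^ l) (y(0 := g \<otimes> y 0))"
    using tr[OF x, of k] tr[OF y(1), of l] by simp
  then show "p' = pt n (x(0 := g \<otimes> x 0))"
    using pt_eq_iff[OF lv[OF x gx] lv[OF y(1,2)]] kl(1) y(4) by metis
qed

lemma CF_action_cyl:
  assumes p: "p \<in> cyl n f" and g: "g \<in> carrier G" and gf: "g \<otimes> f \<in> F n"
  shows "CF_action G C F g p \<in> cyl n (g \<otimes> f)"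
proof -
  obtain x where x: "x \<in> lev n" "x 0 = f" "p = pt n x"
    using p unfolding CF_cylinder_def by auto
  have "x(0 := g \<otimes> x 0) \<in> lev n"
    using x gf by (auto simp: level_iff)
  from pt_in_cyl[OF this] show ?thesis
    using CF_action_pt[OF x(1) g] x gf by simp
qed

text \<open>The action changes the first coordinate only and leaves the following block alone; the
  converse direction holds because the block is determined by the deeper cylinder.\<close>

lemma CF_action_cyl_iff:
  assumes nm: "n \<le> m" and f: "f \<in> F n" and g: "g \<in> carrier G" and gf: "g \<otimes> f \<in> F n"
    and d: "d \<in> word n m" and p: "p \<in> cyl n f"
  shows "CF_action G C F g p \<in> cyl m (g \<otimes> f \<otimes> d) \<longleftrightarrow> p \<in> cyl m (f \<otimes> d)"
proof -
  have *: "CF_action G C F g p \<in> cyl m (g \<otimes> f \<otimes> d)" if "d \<in> word n m" "p \<in> cyl m (f \<otimes> d)" for d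
    using CF_action_cyl[OF that(2) g] F_word_closed[OF nm gf that(1)] g f F_closed word_closed[OF that(1)]
    by (simp add: m_assoc)
  obtain d' where d': "d' \<in> word n m" "p \<in> cyl m (f \<otimes> d')"
    using p cyl_split[OF nm f] by auto
  show ?thesis
  proof
    assume a: "CF_action G C F g p \<in> cyl m (g \<otimes> f \<otimes> d)"
    have "g \<otimes> f \<otimes> d = g \<otimes> f \<otimes> d'"
      using cyl_disjoint[of "g \<otimes> f \<otimes> d" "g \<otimes> f \<otimes> d'" m] *[OF d'] a by auto
    then show "p \<in> cyl m (f \<otimes> d)"
      using F_word_cancel[OF nm gf gf d d'(1)] d' by simp
  qed (use * d in auto)
qed

end

subsection \<open>The measure\<close>

locale CF_system = CF_parameters G C F \<kappa> \<nu>
  for G :: "('a, 'b) monoid_scheme" (structure) and C F \<kappa> \<nu> +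
  fixes \<mu> :: "(nat \<times> (nat \<Rightarrow> 'a)) set measure"
  assumes countable_G: "countable (carrier G)"
    and admissible: "CF_admissible G C F \<nu>"
    and CF_measure: "is_CF_measure G C F \<nu> \<mu>"
begin

abbreviation "act \<equiv> CF_action G C F"

lemma sets_\<mu>: "sets \<mu> = sigma_sets (CF_space G C F) cyls"
  using CF_measure sets_CF_borel unfolding is_CF_measure_def by simp

lemma space_\<mu>: "space \<mu> = CF_space G C F"
  using sets_eq_imp_space_eq[of \<mu> "borel_on (CF_topology G C F)"] CF_measure
  unfolding is_CF_measure_def by (simp add: space_borel_on topspace_CF_topology)

lemma sets_\<mu>': "sets \<mu> = sigma_sets (CF_space G C F) (insert {} cyls)"
  unfolding sets_\<mu> by (rule sigma_sets_eqI) (auto intro: sigma_sets.Basic sigma_sets.Empty)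

lemma cyl_sets [measurable, simp]: "cyl n f \<in> sets \<mu>"
proof (cases "f \<in> F n")
  case True
  then show ?thesis
    unfolding sets_\<mu> cyls_def by (blast intro: sigma_sets.Basic)
qed (simp add: cyl_nonmem)

lemma emeasure_cyl: "f \<in> F n \<Longrightarrow> emeasure \<mu> (cyl n f) = ennreal (wt n f)"
  using CF_measure finite_measure.emeasure_eq_measure[OF \<nu>_finite, of n "{f}"]
  unfolding is_CF_measure_def by simp

lemma emeasure_Union_cyl:
  assumes "H \<subseteq> F n"
  shows "emeasure \<mu> (\<Union>h\<in>H. cyl n h) = ennreal (\<Sum>h\<in>H. wt n h)"
proof -
  have "finite H" using assms F_finite finite_subset by blast
  have "disjoint_family_on (cyl n) H"
    using cyl_disjoint by (auto simp: disjoint_family_on_def)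
  then have "emeasure \<mu> (\<Union>h\<in>H. cyl n h) = (\<Sum>h\<in>H. emeasure \<mu> (cyl n h))"
    using \<open>finite H\<close> by (intro sum_emeasure[symmetric]) auto
  also have "\<dots> = (\<Sum>h\<in>H. ennreal (wt n h))"
    using assms emeasure_cyl by (intro sum.cong) auto
  finally show ?thesis by simp
qed

lemma measure_\<nu>:
  assumes "H \<subseteq> F n"
  shows "measure (\<nu> n) H = (\<Sum>h\<in>H. wt n h)"
proof -
  interpret finite_measure "\<nu> n" by (rule \<nu>_finite)
  have "finite H" using assms F_finite finite_subset by blast
  then show ?thesis
    using assms by (intro finite_measure_eq_sum_singleton) (auto simp: \<nu>_sets)
qed

lemma sets_CF_dom [measurable]: "CF_dom G C F g \<in> sets \<mu>"
  unfolding CF_dom_eq_cyl using F_finite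
  by (intro sets.countable_UN sets.finite_UN image_subsetI) auto

text \<open>Each element counted by the admissibility condition at level \<open>m\<close> yields a
  cylinder inside the right-hand set. Its measure therefore bounds every term from
  \<open>m = n\<close> on, and the terms converge to the measure of the whole level.\<close>

lemma emeasure_level_Int_CF_dom:
  assumes g: "g \<in> carrier G"
  shows "emeasure \<mu> (\<Union>f\<in>F n. cyl n f) \<le> emeasure \<mu> ((\<Union>f\<in>F n. cyl n f) \<inter> CF_dom G C F g)"
    (is "emeasure \<mu> ?X \<le> ?R")
proof (rule LIMSEQ_le_const2)
  let ?A = "\<lambda>m. (F n <#> word n m) \<inter> (inv g <# F m)"
  have "(\<lambda>m. measure (\<nu> m) (?A m)) \<longlonglongrightarrow> measure (\<nu> n) (F n)"
    using admissible g unfolding CF_admissible_def by blast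
  then show "(\<lambda>m. ennreal (measure (\<nu> m) (?A m))) \<longlonglongrightarrow> emeasure \<mu> ?X"
    using tendsto_ennrealI emeasure_Union_cyl[of "F n" n] measure_\<nu>[of "F n" n] by simp
  have "ennreal (measure (\<nu> m) (?A m)) \<le> ?R" if nm: "n \<le> m" for m
  proof -
    have sub: "?A m \<subseteq> F m"
      using F_word_closed[OF nm] by (auto simp: set_mult_def)
    have "cyl m h \<subseteq> ?X \<inter> CF_dom G C F g" if h: "h \<in> ?A m" for h
    proof -
      obtain f d where fd: "f \<in> F n" "d \<in> word n m" "h = f \<otimes> d"
        using h by (auto simp: set_mult_def)
      obtain k where k: "k \<in> F m" "h = inv g \<otimes> k"
        using h by (auto simp: l_coset_def)
      have "g \<otimes> h \<in> F m"
        using k g F_closed[OF k(1)] by (simp flip: m_assoc)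
      then have "cyl m h \<subseteq> CF_dom G C F g"
        using h sub unfolding CF_dom_eq_cyl by blast
      moreover have "cyl m h \<subseteq> cyl n f"
        unfolding cyl_split[OF nm fd(1)] fd(3) using fd(2) by blast
      ultimately show ?thesis using fd(1) by blast
    qed
    then have "(\<Union>h\<in>?A m. cyl m h) \<subseteq> ?X \<inter> CF_dom G C F g" by blast
    then have "emeasure \<mu> (\<Union>h\<in>?A m. cyl m h) \<le> ?R"
      using F_finite by (intro emeasure_mono sets.Int sets.finite_UN) auto
    then show ?thesis
      using emeasure_Union_cyl[OF sub] measure_\<nu>[OF sub] by simp
  qed
  then show "\<exists>N. \<forall>m\<ge>N. ennreal (measure (\<nu> m) (?A m)) \<le> ?R" by blast
qed

text \<open>Each level has finite measure, so the previous inequality makes its part outside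
  \<open>CF_dom G C F g\<close> null. There are countably many levels and countably many
  \<open>g\<close>.\<close>

lemma AE_CF_dom_all: "AE p in \<mu>. p \<in> CF_dom_all G C F"
proof -
  have "AE p in \<mu>. p \<in> CF_dom G C F g" if g: "g \<in> carrier G" for g
  proof -
    have "(\<Union>f\<in>F n. cyl n f) - CF_dom G C F g \<in> null_sets \<mu>" for n
    proof -
      let ?X = "\<Union>f\<in>F n. cyl n f"
      have X: "?X \<in> sets \<mu>" using F_finite by auto
      have fin: "emeasure \<mu> ?X \<noteq> \<infinity>" using emeasure_Union_cyl[of "F n" n] by simp
      have "emeasure \<mu> (?X - CF_dom G C F g) = emeasure \<mu> (?X - ?X \<inter> CF_dom G C F g)"
        by (simp add: Diff_Int)
      also have "\<dots> = emeasure \<mu> ?X - emeasure \<mu> (?X \<inter> CF_dom G C F g)"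
        using X fin by (intro emeasure_Diff) (auto simp: top_unique dest!: emeasure_mono[of "?X \<inter> CF_dom G C F g" ?X \<mu>, rotated])
      also have "\<dots> = 0"
        using emeasure_level_Int_CF_dom[OF g, of n] fin
        by (intro diff_eq_0_ennreal) (simp_all add: less_top)
      finally show ?thesis using X by auto
    qed
    then have "(\<Union>n. (\<Union>f\<in>F n. cyl n f) - CF_dom G C F g) \<in> null_sets \<mu>"
      by (rule null_sets_UN)
    then show ?thesis
      by (rule AE_I') (auto simp: space_\<mu> CF_space_eq_cyl)
  qed
  then show ?thesis
    unfolding CF_dom_all_def using countable_G by (simp add: AE_ball_countable)
qed

text \<open>On a cylinder the action has the constant Jacobian
  \<open>wt n (g \<otimes> f) / wt n f\<close>, written here without division. If \<open>h\<close>
  extends \<open>g \<otimes> f\<close> by a block, both weights carry the same factor for that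
  block; otherwise the two cylinders are nested the other way or disjoint.\<close>

lemma act_vimage_cyl:
  assumes f: "f \<in> F n" and g: "g \<in> carrier G" and gf: "g \<otimes> f \<in> F n" and h: "h \<in> F m"
  shows "{p \<in> cyl n f. act g p \<in> cyl m h} \<in> sets \<mu> \<and>
    emeasure \<mu> {p \<in> cyl n f. act g p \<in> cyl m h} * wt n (g \<otimes> f) =
    emeasure \<mu> (cyl n (g \<otimes> f) \<inter> cyl m h) * wt n f"
proof -
  have act: "act g p \<in> cyl n (g \<otimes> f)" if "p \<in> cyl n f" for p
    using CF_action_cyl[OF that g gf] .
  have ent: ?thesis if "cyl n (g \<otimes> f) \<inter> cyl m h = {}"
  proof -
    have "{p \<in> cyl n f. act g p \<in> cyl m h} = {}" using act that by blast
    then show ?thesis by (simp only: that) simp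
  qed
  show ?thesis
  proof (cases "n \<le> m")
    case True
    show ?thesis
    proof (cases "\<exists>d\<in>word n m. h = g \<otimes> f \<otimes> d")
      case T: True
      then obtain d where d: "d \<in> word n m" "h = g \<otimes> f \<otimes> d" by blast
      have s1: "cyl m (f \<otimes> d) \<subseteq> cyl n f" and s2: "cyl m h \<subseteq> cyl n (g \<otimes> f)"
        unfolding cyl_split[OF True f] cyl_split[OF True gf] d(2) using d(1) by blast+
      have "{p \<in> cyl n f. act g p \<in> cyl m h} = cyl m (f \<otimes> d)"
        using CF_action_cyl_iff[OF True f g gf d(1)] s1 d(2) by blast
      moreover have "cyl n (g \<otimes> f) \<inter> cyl m h = cyl m h" using s2 by blast
      ultimately show ?thesis
        using emeasure_cyl[OF F_word_closed[OF True f d(1)]] emeasure_cyl[OF h]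
          wt_word[OF True f d(1)] wt_word[OF True gf d(1)] d(2)
        by (simp flip: ennreal_mult'' add: mult_ac)
    next
      case False
      then have "cyl m (g \<otimes> f \<otimes> d) \<inter> cyl m h = {}" if "d \<in> word n m" for d
        using that cyl_disjoint by metis
      then have "cyl n (g \<otimes> f) \<inter> cyl m h = {}"
        unfolding cyl_split[OF True gf] by blast
      then show ?thesis by (rule ent)
    qed
  next
    case False
    then have "cyl n (g \<otimes> f) \<subseteq> cyl m h \<or> cyl n (g \<otimes> f) \<inter> cyl m h = {}"
      using cyl_nested[OF _ h gf] by simp
    then show ?thesis
    proof
      assume s: "cyl n (g \<otimes> f) \<subseteq> cyl m h"
      then have "{p \<in> cyl n f. act g p \<in> cyl m h} = cyl n f" using act by blast
      moreover have "cyl n (g \<otimes> f) \<inter> cyl m h = cyl n (g \<otimes> f)" using s by blast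
      ultimately show ?thesis
        using emeasure_cyl[OF f] emeasure_cyl[OF gf] by (simp add: mult.commute)
    qed (rule ent)
  qed
qed

text \<open>Measurability is stated on a single cylinder because there \<open>act g\<close> is one
  explicit translation; elsewhere it may be given by other formulas or be unspecified.\<close>

lemma act_measurable:
  assumes f: "f \<in> F n" and g: "g \<in> carrier G" and gf: "g \<otimes> f \<in> F n"
  shows "act g \<in> measurable (restrict_space \<mu> (cyl n f)) \<mu>"
proof (rule measurable_sigma_sets[OF sets_\<mu> cyls_subset])
  have sp: "space (restrict_space \<mu> (cyl n f)) = cyl n f"
    using cyl_subset_space by (auto simp: space_restrict_space space_\<mu>)
  show "act g \<in> space (restrict_space \<mu> (cyl n f)) \<rightarrow> CF_space G C F"
    using CF_action_cyl[OF _ g gf] cyl_subset_space unfolding sp by blast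
  fix y assume "y \<in> cyls"
  then obtain m h where y: "y = cyl m h" "h \<in> F m" unfolding cyls_def by auto
  have "act g -` y \<inter> space (restrict_space \<mu> (cyl n f)) = {p \<in> cyl n f. act g p \<in> cyl m h}"
    unfolding sp y by auto
  then show "act g -` y \<inter> space (restrict_space \<mu> (cyl n f)) \<in> sets (restrict_space \<mu> (cyl n f))"
    using act_vimage_cyl[OF f g gf y(2)] by (auto simp: sets_restrict_space_iff)
qed

lemma act_vimage_sets:
  assumes "f \<in> F n" "g \<in> carrier G" "g \<otimes> f \<in> F n" "B \<in> sets \<mu>"
  shows "{p \<in> cyl n f. act g p \<in> B} \<in> sets \<mu>"
proof -
  have sp: "space (restrict_space \<mu> (cyl n f)) = cyl n f"
    using cyl_subset_space by (auto simp: space_restrict_space space_\<mu>)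
  have "act g -` B \<inter> cyl n f \<in> sets (restrict_space \<mu> (cyl n f))"
    using measurable_sets[OF act_measurable[OF assms(1-3)] assms(4)] unfolding sp .
  moreover have "act g -` B \<inter> cyl n f = {p \<in> cyl n f. act g p \<in> B}" by auto
  ultimately show ?thesis by (simp add: sets_restrict_space_iff)
qed

text \<open>Both sides are measures in \<open>B\<close> that agree on the pi-system of cylinders.
  Countably many cylinders of finite measure cover the space, so the measures coincide.\<close>

lemma emeasure_act_vimage:
  assumes f: "f \<in> F n" and g: "g \<in> carrier G" and gf: "g \<otimes> f \<in> F n" and B: "B \<in> sets \<mu>"
  shows "emeasure \<mu> {p \<in> cyl n f. act g p \<in> B} * wt n (g \<otimes> f) =
    emeasure \<mu> (cyl n (g \<otimes> f) \<inter> B) * wt n f"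
proof -
  \<comment> \<open>\<open>?M\<close> and \<open>?N\<close> evaluate at \<open>B\<close> to the left
    and the right side of the claim.\<close>
  let ?M = "scale_measure (wt n (g \<otimes> f)) (distr (restrict_space \<mu> (cyl n f)) \<mu> (act g))"
  let ?N = "scale_measure (wt n f) (density \<mu> (indicator (cyl n (g \<otimes> f))))"
  have sp: "space (restrict_space \<mu> (cyl n f)) = cyl n f"
    using cyl_subset_space by (auto simp: space_restrict_space space_\<mu>)
  have M: "emeasure ?M A = emeasure \<mu> {p \<in> cyl n f. act g p \<in> A} * wt n (g \<otimes> f)"
    if A: "A \<in> sets \<mu>" for A
  proof -
    have "emeasure ?M A = wt n (g \<otimes> f) * emeasure (restrict_space \<mu> (cyl n f)) (act g -` A \<inter> cyl n f)"
      using emeasure_distr[OF act_measurable[OF f g gf] A] by (simp add: sp)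
    also have "act g -` A \<inter> cyl n f = {p \<in> cyl n f. act g p \<in> A}" by auto
    also have "emeasure (restrict_space \<mu> (cyl n f)) \<dots> = emeasure \<mu> \<dots>"
      by (rule emeasure_restrict_space) auto
    finally show ?thesis by (simp add: mult.commute)
  qed
  have N: "emeasure ?N A = emeasure \<mu> (cyl n (g \<otimes> f) \<inter> A) * wt n f" if "A \<in> sets \<mu>" for A
    using that by (simp add: emeasure_restricted mult.commute)
  have cs: "A \<in> sets \<mu>" if "A \<in> insert {} cyls" for A
    using that unfolding sets_\<mu>' by blast
  have "?M = ?N"
  proof (rule measure_eqI_generator_eq_countable[OF Int_stable_cyls, where A = cyls])
    show "insert {} cyls \<subseteq> Pow (CF_space G C F)" using cyls_subset by auto
    show "emeasure ?M A = emeasure ?N A" if "A \<in> insert {} cyls" for A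
      using that act_vimage_cyl[OF f g gf] unfolding M[OF cs[OF that]] N[OF cs[OF that]]
      unfolding cyls_def by auto
    show "sets ?M = sigma_sets (CF_space G C F) (insert {} cyls)"
      "sets ?N = sigma_sets (CF_space G C F) (insert {} cyls)"
      by (simp_all add: sets_\<mu>')
    show "cyls \<subseteq> insert {} cyls" by auto
    show "\<Union> cyls = CF_space G C F"
      unfolding CF_space_eq_cyl cyls_def by auto
    show "countable cyls" by (rule countable_cyls)
    fix A assume A: "A \<in> cyls"
    have "emeasure \<mu> {p \<in> cyl n f. act g p \<in> A} \<le> emeasure \<mu> (cyl n f)"
      by (rule emeasure_mono) auto
    then have "emeasure \<mu> {p \<in> cyl n f. act g p \<in> A} < \<infinity>"
      using emeasure_cyl[OF f] by (simp add: le_less_trans)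
    then show "emeasure ?M A \<noteq> \<infinity>"
      using M[OF cs] A by (auto simp: ennreal_mult_eq_top_iff)
  qed
  then show ?thesis
    using M[OF B] N[OF B] by simp
qed

subsection \<open>Density of measurable sets in cylinders\<close>

text \<open>As \<open>F m\<close> is finite, these are finite unions of cylinders, all of one level
  so that the pieces are disjoint.\<close>

definition clopen_set :: "(nat \<times> (nat \<Rightarrow> 'a)) set set \<Rightarrow> bool" where
  "clopen_set D \<longleftrightarrow> (\<exists>m H. H \<subseteq> F m \<and> D = (\<Union>h\<in>H. cyl m h))"

text \<open>Replacing each \<open>h\<close> by its products with all blocks up to \<open>m'\<close>
  allows arbitrarily high levels and brings two clopen sets to a common level.\<close>

lemma Union_cyl_refine:
  assumes "H \<subseteq> F m" "m \<le> m'"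
  shows "\<exists>H'. H' \<subseteq> F m' \<and> (\<Union>h\<in>H. cyl m h) = (\<Union>h\<in>H'. cyl m' h)"
proof (intro exI conjI)
  show "(\<Union>h\<in>H. (\<lambda>d. h \<otimes> d) ` word m m') \<subseteq> F m'"
    using assms F_word_closed by blast
  show "(\<Union>h\<in>H. cyl m h) = (\<Union>h\<in>(\<Union>h\<in>H. (\<lambda>d. h \<otimes> d) ` word m m'). cyl m' h)"
  proof -
    have "(\<Union>h\<in>H. cyl m h) = (\<Union>h\<in>H. \<Union>d\<in>word m m'. cyl m' (h \<otimes> d))"
      using assms by (intro SUP_cong refl cyl_split) auto
    then show ?thesis by auto
  qed
qed

lemma clopen_set_refine:
  assumes "clopen_set D"
  obtains m H where "m \<ge> N" "H \<subseteq> F m" "D = (\<Union>h\<in>H. cyl m h)"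
proof -
  obtain m H where "H \<subseteq> F m" "D = (\<Union>h\<in>H. cyl m h)"
    using assms unfolding clopen_set_def by blast
  with Union_cyl_refine[of H m "max m N"] that[of "max m N"] show ?thesis
    by (metis max.cobounded1 max.cobounded2)
qed

lemma clopen_set_Un:
  assumes "clopen_set D" "clopen_set D'"
  shows "clopen_set (D \<union> D')"
proof -
  obtain m H where m: "H \<subseteq> F m" "D = (\<Union>h\<in>H. cyl m h)"
    using assms unfolding clopen_set_def by blast
  obtain m' H' where m': "m' \<ge> m" "H' \<subseteq> F m'" "D' = (\<Union>h\<in>H'. cyl m' h)"
    by (rule clopen_set_refine[OF assms(2)])
  obtain H'' where "H'' \<subseteq> F m'" "D = (\<Union>h\<in>H''. cyl m' h)"
    using Union_cyl_refine[OF m(1) m'(1)] m(2) by auto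
  with m' show ?thesis
    unfolding clopen_set_def by (intro exI[of _ m'] exI[of _ "H'' \<union> H'"]) auto
qed

lemma clopen_set_empty: "clopen_set {}"
  unfolding clopen_set_def by (rule exI[of _ 0], rule exI[of _ "{}"]) simp

lemma clopen_set_UN: "(\<And>i. clopen_set (D i)) \<Longrightarrow> clopen_set (\<Union>i<k. D i)" for k :: nat
  by (induction k) (auto simp: clopen_set_empty lessThan_Suc intro: clopen_set_Un)

lemma clopen_set_sets: "clopen_set D \<Longrightarrow> D \<in> sets \<mu>"
  unfolding clopen_set_def using F_finite finite_subset
  by (metis (no_types, lifting) cyl_sets sets.finite_UN)

lemma cyl_0_subset: "cyl 0 \<one> \<subseteq> (\<Union>f\<in>F m. cyl m f)"
  using cyl_split[of 0 m \<one>] word_in_F[of 0 m] F_0 word_closed by auto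

text \<open>The restriction of \<open>\<mu>\<close> to the lowest level,
  \<open>cyl 0 \<one>\<close>. It is a finite measure, whereas \<open>\<mu>\<close> is only
  sigma-finite, so approximation arguments are run with it.\<close>

definition base :: "(nat \<times> (nat \<Rightarrow> 'a)) set measure" where
  "base = density \<mu> (indicator (cyl 0 \<one>))"

lemma sets_base [simp]: "sets base = sets \<mu>"
  by (simp add: base_def)

lemma emeasure_base: "A \<in> sets \<mu> \<Longrightarrow> emeasure base A = emeasure \<mu> (cyl 0 \<one> \<inter> A)"
  unfolding base_def by (rule emeasure_restricted) auto

lemma finite_measure_base: "finite_measure base"
proof
  have "emeasure base (space base) \<le> emeasure \<mu> (cyl 0 \<one>)"
    using emeasure_base[of "space \<mu>"] by (auto simp: base_def intro: emeasure_mono)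
  then show "emeasure base (space base) \<noteq> \<infinity>"
    using emeasure_cyl[of \<one> 0] F_0 by (auto simp: top_unique)
qed

text \<open>The sets that can be approximated in \<open>base\<close> by clopen sets contain the
  cylinders and are closed under complements and countable unions.\<close>

lemma clopen_approx:
  assumes "E \<in> sets \<mu>" and "\<delta> > 0"
  shows "\<exists>D. clopen_set D \<and> measure base ((E - D) \<union> (D - E)) < \<delta>"
proof -
  interpret finite_measure base by (rule finite_measure_base)
  have "E \<in> sigma_sets (CF_space G C F) cyls"
    using assms sets_\<mu> by simp
  then show ?thesis
    using \<open>\<delta> > 0\<close>
  proof (induction E arbitrary: \<delta> rule: sigma_sets.induct)
    case (Basic E)
    then obtain m h where "E = cyl m h" "h \<in> F m" unfolding cyls_def by auto
    then have "clopen_set E"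
      unfolding clopen_set_def by (intro exI[of _ m] exI[of _ "{h}"]) auto
    then show ?case using Basic by (intro exI[of _ E]) simp
  next
    case Empty
    then show ?case using clopen_set_empty by (intro exI[of _ "{}"]) simp
  next
    case (Compl E)
    then obtain D where D: "clopen_set D" "measure base ((E - D) \<union> (D - E)) < \<delta>" by blast
    then obtain m H where m: "H \<subseteq> F m" "D = (\<Union>h\<in>H. cyl m h)"
      unfolding clopen_set_def by blast
    \<comment> \<open>The full complement of \<open>D\<close> need not be a finite union of
      cylinders, so \<open>?D\<close> is the complement within level \<open>m\<close>. That level
      contains \<open>cyl 0 \<one>\<close>, so \<open>base\<close> does not see the
      difference.\<close>
    let ?S = "CF_space G C F" and ?D = "\<Union>h\<in>F m - H. cyl m h"
    have D': "clopen_set ?D" unfolding clopen_set_def by blast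
    have [measurable]: "E \<in> sets \<mu>" "D \<in> sets \<mu>" "?D \<in> sets \<mu>" "?S \<in> sets \<mu>"
      using Compl.hyps clopen_set_sets[OF D(1)] clopen_set_sets[OF D'] sets.top[of \<mu>]
      by (simp_all add: sets_\<mu> space_\<mu>)
    have aux: "Z \<inter> (S - E - D' \<union> (D' - (S - E))) = Z \<inter> ((E - D) \<union> (D - E))"
      if "D \<inter> D' = {}" "Z \<subseteq> D \<union> D'" "Z \<subseteq> S" for Z S D' :: "(nat \<times> (nat \<Rightarrow> 'a)) set set"
      using that by blast
    have "D \<inter> ?D = {}" 
    proof -
      have "cyl m h \<inter> cyl m h' = {}" if "h \<in> H" "h' \<in> F m - H" for h h'
        using that by (intro cyl_disjoint) auto
      then show ?thesis unfolding m(2) by blast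
    qed
    moreover have "cyl 0 \<one> \<subseteq> D \<union> ?D" using cyl_0_subset[of m] m by blast
    moreover have "cyl 0 \<one> \<subseteq> ?S" by (rule cyl_subset_space)
    ultimately have "cyl 0 \<one> \<inter> (?S - E - ?D \<union> (?D - (?S - E))) = cyl 0 \<one> \<inter> ((E - D) \<union> (D - E))"
      by (rule aux)
    then have "emeasure base (?S - E - ?D \<union> (?D - (?S - E))) = emeasure base ((E - D) \<union> (D - E))"
      by (simp add: emeasure_base)
    then have "measure base (?S - E - ?D \<union> (?D - (?S - E))) < \<delta>"
      using D(2) by (simp add: measure_def)
    then show ?case using D' by blast
  next
    case (Union E)
    have E: "E i \<in> sets base" for i using Union.hyps by (simp add: sets_\<mu>)
    \<comment> \<open>Half of the error goes to the tail of the union, which tends to the empty set,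
      and half to approximating the first \<open>k\<close> sets.\<close>
    define R where "R k = (\<Union>i. E i) - (\<Union>i<k. E i)" for k :: nat
    have "(\<lambda>k. measure base (R k)) \<longlonglongrightarrow> measure base (\<Inter>k. R k)"
      by (rule finite_Lim_measure_decseq) (use E in \<open>auto simp: R_def decseq_def\<close>)
    moreover have "(\<Inter>k. R k) = {}" unfolding R_def by blast
    ultimately have "eventually (\<lambda>k. measure base (R k) < \<delta> / 2) sequentially"
      using Union.prems by (intro order_tendstoD(2)) auto
    then obtain k where k: "measure base (R k) < \<delta> / 2"
      by (auto simp: eventually_sequentially)
    \<comment> \<open>The \<open>k\<close> errors add up to at most \<open>\<delta> / 2\<close>; the
      summand \<open>1\<close> keeps the divisor positive when \<open>k = 0\<close>.\<close>
    have "\<exists>D. clopen_set D \<and> measure base ((E i - D) \<union> (D - E i)) < \<delta> / (2 * (real k + 1))" for i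
      using Union.IH[of "\<delta> / (2 * (real k + 1))" i] Union.prems by simp
    then obtain D where D: "\<And>i. clopen_set (D i)"
      "\<And>i. measure base ((E i - D i) \<union> (D i - E i)) < \<delta> / (2 * (real k + 1))" by metis
    have Ds: "D i \<in> sets base" for i using clopen_set_sets[OF D(1)] by simp
    let ?D = "\<Union>i<k. D i"
    let ?V = "\<Union>i<k. (E i - D i) \<union> (D i - E i)"
    have "measure base (((\<Union>i. E i) - ?D) \<union> (?D - (\<Union>i. E i))) \<le> measure base (R k \<union> ?V)"
      by (rule finite_measure_mono) (use E Ds in \<open>auto simp: R_def\<close>)
    also have "\<dots> \<le> measure base (R k) + measure base ?V"
      by (rule measure_Un_le) (use E Ds in \<open>auto simp: R_def\<close>)
    also have "measure base ?V \<le> (\<Sum>i<k. measure base ((E i - D i) \<union> (D i - E i)))"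
      by (rule measure_UNION_le) (use E Ds in auto)
    also have "\<dots> \<le> (\<Sum>i<k. \<delta> / (2 * (real k + 1)))"
      using D(2) by (intro sum_mono less_imp_le)
    also have "\<dots> \<le> \<delta> / 2"
      using Union.prems by (simp add: field_simps)
    finally have "measure base (((\<Union>i. E i) - ?D) \<union> (?D - (\<Union>i. E i))) < \<delta>"
      using k by simp
    then show ?case using clopen_set_UN[of D k] D(1) by blast
  qed
qed

text \<open>A density argument: if every cylinder of level at least \<open>N\<close> missed
  \<open>E\<close> by more than the proportion \<open>\<epsilon>\<close>, then so would any clopen
  set of such a level, and \<open>E\<close> could not be approximated well by clopen sets.\<close>

lemma dense_cylinder:
  assumes E: "E \<in> sets \<mu>" and pos: "emeasure \<mu> (cyl 0 \<one> \<inter> E) > 0" and \<epsilon>: "\<epsilon> > 0"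
  shows "\<exists>m\<ge>N. \<exists>f\<in>F m. emeasure \<mu> (cyl m f - E) \<le> ennreal (\<epsilon> * wt m f)"
proof (rule ccontr)
  assume no: "\<not> ?thesis"
  interpret finite_measure base by (rule finite_measure_base)
  define a where "a = measure base E"
  have "ennreal a > 0"
    using pos emeasure_base[OF E] by (simp add: a_def emeasure_eq_measure)
  then have a: "a > 0" by simp
  \<comment> \<open>The approximating \<open>D\<close> will satisfy
    \<open>\<epsilon> * measure base D < \<delta>\<close> and
    \<open>a < measure base D + \<delta>\<close>. Together they give
    \<open>\<epsilon> * a < \<delta> * (1 + \<epsilon>)\<close>, which this choice of
    \<open>\<delta>\<close> rules out.\<close>
  define \<delta> where "\<delta> = \<epsilon> * a / 2 / (1 + \<epsilon>)"
  have \<delta>: "\<delta> > 0" "\<delta> * (1 + \<epsilon>) < \<epsilon> * a"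
  proof -
    show "\<delta> > 0" using \<epsilon> a by (simp add: \<delta>_def)
    have "\<delta> * (1 + \<epsilon>) = \<epsilon> * a / 2" using \<epsilon> by (simp add: \<delta>_def field_simps)
    moreover have "\<epsilon> * a > 0" using \<epsilon> a by simp
    ultimately show "\<delta> * (1 + \<epsilon>) < \<epsilon> * a" by linarith
  qed
  obtain D where D: "clopen_set D" "measure base ((E - D) \<union> (D - E)) < \<delta>"
    using clopen_approx[OF E \<delta>(1)] by blast
  obtain m H where m: "m \<ge> N" "H \<subseteq> F m" "D = (\<Union>h\<in>H. cyl m h)"
    by (rule clopen_set_refine[OF D(1)])
  have Ds: "D \<in> sets \<mu>" by (rule clopen_set_sets[OF D(1)])
  have finH: "finite H" using m(2) F_finite finite_subset by blast
  \<comment> \<open>A level \<open>m\<close> cylinder lies inside \<open>cyl 0 \<one>\<close>, where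
    \<open>base\<close> equals \<open>\<mu>\<close> and the assumption applies, or is disjoint from
    it and has \<open>base\<close> measure zero.\<close>
  have le: "\<epsilon> * measure base (cyl m h) \<le> measure base (cyl m h - E)" if h: "h \<in> H" for h
  proof -
    have hF: "h \<in> F m" using h m(2) by blast
    show ?thesis
    proof (cases "cyl m h \<subseteq> cyl 0 \<one>")
      case True
      then have "cyl 0 \<one> \<inter> cyl m h = cyl m h" "cyl 0 \<one> \<inter> (cyl m h - E) = cyl m h - E"
        by blast+
      then have "emeasure base (cyl m h) = ennreal (wt m h)"
        "emeasure base (cyl m h - E) = emeasure \<mu> (cyl m h - E)"
        using E emeasure_cyl[OF hF] by (simp_all add: emeasure_base)
      moreover have "ennreal (\<epsilon> * wt m h) \<le> emeasure \<mu> (cyl m h - E)"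
        using no m(1) hF by (meson linear)
      ultimately have "measure base (cyl m h) = wt m h"
        "ennreal (\<epsilon> * wt m h) \<le> ennreal (measure base (cyl m h - E))"
        by (simp_all add: emeasure_eq_measure)
      then show ?thesis
        by (metis ennreal_le_iff measure_nonneg)
    next
      case False
      then have "cyl 0 \<one> \<inter> cyl m h = {}"
        using cyl_nested[of 0 m \<one> h] hF F_0 by blast
      then have "measure base (cyl m h) = 0"
        using emeasure_base[of "cyl m h"] by (simp add: measure_def)
      then show ?thesis by simp
    qed
  qed
  have dj: "disjoint_family_on (cyl m) H"
    using cyl_disjoint by (auto simp: disjoint_family_on_def)
  have "\<epsilon> * measure base D = (\<Sum>h\<in>H. \<epsilon> * measure base (cyl m h))"
    unfolding m(3) sum_distrib_left[symmetric]
    by (subst finite_measure_finite_Union) (use finH dj in auto)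
  also have "\<dots> \<le> (\<Sum>h\<in>H. measure base (cyl m h - E))"
    by (rule sum_mono) (rule le)
  also have "\<dots> = measure base (\<Union>h\<in>H. cyl m h - E)"
    by (rule finite_measure_finite_Union[symmetric])
       (use finH dj E in \<open>auto simp: disjoint_family_on_def\<close>)
  also have "\<dots> \<le> measure base ((E - D) \<union> (D - E))"
    by (rule finite_measure_mono) (use E Ds in \<open>auto simp: m(3)\<close>)
  finally have 1: "\<epsilon> * measure base D < \<delta>" using D(2) by simp
  have "a \<le> measure base (D \<union> ((E - D) \<union> (D - E)))"
    unfolding a_def by (rule finite_measure_mono) (use E Ds in auto)
  also have "\<dots> \<le> measure base D + measure base ((E - D) \<union> (D - E))"
    by (rule measure_Un_le) (use E Ds in auto)
  finally have "a < measure base D + \<delta>" using D(2) by simp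
  then have "\<epsilon> * a < \<epsilon> * measure base D + \<epsilon> * \<delta>"
    using \<epsilon> by (simp flip: distrib_left)
  then show False using 1 \<delta>(2) by (simp add: algebra_simps)
qed

end

subsection \<open>Odometers\<close>

context group
begin

text \<open>Multiplying by \<open>K\<close> absorbs \<open>H\<close>, as \<open>H <#> K = K\<close>.
  This computes the bonding map of the odometer on representatives.\<close>

lemma lcoset_mult_subgroup:
  assumes "subgroup H G" "subgroup K G" "H \<subseteq> K" "a \<in> carrier G"
  shows "(a <# H) <#> K = a <# K"
proof -
  have HK: "H <#> K = K"
  proof
    show "H <#> K \<subseteq> K"
      using assms by (auto simp: set_mult_def intro: subgroup.m_closed)
    show "K \<subseteq> H <#> K"
    proof
      fix k assume k: "k \<in> K"
      then have "k = \<one> \<otimes> k" using assms subgroup.mem_carrier by fastforce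
      then show "k \<in> H <#> K"
        using k subgroup.one_closed[OF assms(1)] unfolding set_mult_def by blast
    qed
  qed
  show ?thesis
    using setmult_lcos_assoc[of H K a] assms subgroup.subset HK by metis
qed

lemma lcosets_subset: "subgroup H G \<Longrightarrow> A \<in> lcosets H \<Longrightarrow> A \<subseteq> carrier G"
  using lcosets_subset_PowG by blast

lemma lcosets_act:
  assumes "subgroup H G" "A \<in> lcosets H" "g \<in> carrier G"
  shows "g <# A \<in> lcosets H"
  using assms lcos_m_assoc[OF subgroup.subset[OF assms(1)]] unfolding LCOSETS_def by auto

text \<open>Identifies the stabiliser of the coset of \<open>a\<close> as the conjugate of
  \<open>H\<close> by \<open>a\<close>.\<close>

lemma lcoset_stabilizer_iff:
  assumes H: "subgroup H G" and a: "a \<in> carrier G" and g: "g \<in> carrier G"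
  shows "g <# (a <# H) = a <# H \<longleftrightarrow> inv a \<otimes> g \<otimes> a \<in> H"
proof -
  have "g <# (a <# H) = (g \<otimes> a) <# H"
    using lcos_m_assoc[OF subgroup.subset[OF H] g a] .
  moreover have "(g \<otimes> a) <# H = a <# H \<longleftrightarrow> g \<otimes> a \<in> a <# H"
    using lcos_self[of "g \<otimes> a" H] l_repr_independence[of "g \<otimes> a" a H] H a g by auto
  moreover have "g \<otimes> a \<in> a <# H \<longleftrightarrow> inv a \<otimes> (g \<otimes> a) \<in> H"
    using subgroup.lcos_module_imp[OF H is_group a] subgroup.lcos_module_rev[OF H is_group a] a g by auto
  ultimately show ?thesis
    using a g by (simp add: m_assoc)
qed

lemma subgroup_stabilizer:
  assumes B: "B \<subseteq> carrier G"
  shows "subgroup {g \<in> carrier G. g <# B = B} G"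
proof (rule subgroupI)
  show "{g \<in> carrier G. g <# B = B} \<noteq> {}"
    using lcos_mult_one[OF B] by blast
next
  fix a assume "a \<in> {g \<in> carrier G. g <# B = B}"
  then have a: "a \<in> carrier G" "a <# B = B" by auto
  have "inv a <# B = inv a <# (a <# B)" by (simp only: a(2))
  also have "\<dots> = B"
    using lcos_m_assoc[OF B inv_closed[OF a(1)] a(1)] a(1) lcos_mult_one[OF B] by simp
  finally show "inv a \<in> {g \<in> carrier G. g <# B = B}" using a by simp
next
  fix a b assume "a \<in> {g \<in> carrier G. g <# B = B}" "b \<in> {g \<in> carrier G. g <# B = B}"
  then show "a \<otimes> b \<in> {g \<in> carrier G. g <# B = B}"
    using lcos_m_assoc[OF B, of a b] by auto
qed auto

text \<open>Orbit-stabiliser: a coset of the stabiliser consists of the elements that move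
  \<open>B\<close> to one given translate, and the translates of \<open>B\<close> are among the
  finitely many cosets of \<open>H\<close>.\<close>

lemma finite_index_stabilizer:
  assumes H: "finite_index_subgroup G H" and B: "B \<in> lcosets H"
  shows "finite_index_subgroup G {g \<in> carrier G. g <# B = B}"
proof -
  let ?S = "{g \<in> carrier G. g <# B = B}"
  have Bc: "B \<subseteq> carrier G"
    using H B lcosets_subset unfolding finite_index_subgroup_def by blast
  have sub: "subgroup ?S G" by (rule subgroup_stabilizer[OF Bc])
  have eq: "g <# ?S = {h \<in> carrier G. h <# B = g <# B}" if g: "g \<in> carrier G" for g
  proof (intro equalityI subsetI)
    fix h assume "h \<in> g <# ?S"
    then obtain k where k: "k \<in> carrier G" "k <# B = B" "h = g \<otimes> k"
      unfolding l_coset_def[of G g] by auto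
    then have "h <# B = g <# B"
      using lcos_m_assoc[OF Bc g k(1)] by simp
    then show "h \<in> {h \<in> carrier G. h <# B = g <# B}"
      using g k by simp
  next
    fix h assume "h \<in> {h \<in> carrier G. h <# B = g <# B}"
    then have h: "h \<in> carrier G" "h <# B = g <# B" by auto
    have "(inv g \<otimes> h) <# B = inv g <# (h <# B)"
      using lcos_m_assoc[OF Bc inv_closed[OF g] h(1)] by simp
    also have "\<dots> = (inv g \<otimes> g) <# B"
      unfolding h(2) using lcos_m_assoc[OF Bc inv_closed[OF g] g] by simp
    also have "\<dots> = B" using g lcos_mult_one[OF Bc] by simp
    finally have "inv g \<otimes> h \<in> ?S" using g h by simp
    then show "h \<in> g <# ?S"
      using subgroup.lcos_module_rev[OF sub is_group g h(1)] by simp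
  qed
  have "lcosets ?S \<subseteq> (\<lambda>x. {h \<in> carrier G. h <# B = x}) ` (lcosets H)"
    using eq lcosets_act[OF _ B] H unfolding LCOSETS_def[of G ?S] finite_index_subgroup_def by auto
  then have "finite (lcosets ?S)"
    using H unfolding finite_index_subgroup_def by (meson finite_imageI finite_subset)
  then show ?thesis
    using sub unfolding finite_index_subgroup_def by simp
qed

lemma mem_conjugate_iff:
  assumes "H \<subseteq> carrier G" "g \<in> carrier G"
  shows "x \<in> (g <# H) #> inv g \<longleftrightarrow> x \<in> carrier G \<and> inv g \<otimes> x \<otimes> g \<in> H"
proof
  assume "x \<in> (g <# H) #> inv g"
  then obtain h where h: "h \<in> H" "x = g \<otimes> h \<otimes> inv g"
    by (auto simp: l_coset_def r_coset_def)
  then have "h \<in> carrier G" using assms by auto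
  moreover have "inv g \<otimes> x \<otimes> g = h"
    using assms \<open>h \<in> carrier G\<close> h(2) by (simp add: m_assoc) (simp flip: m_assoc)
  ultimately show "x \<in> carrier G \<and> inv g \<otimes> x \<otimes> g \<in> H"
    using assms h by auto
next
  assume x: "x \<in> carrier G \<and> inv g \<otimes> x \<otimes> g \<in> H"
  have "x = g \<otimes> (inv g \<otimes> x \<otimes> g) \<otimes> inv g"
    using assms x by (simp add: m_assoc) (simp flip: m_assoc)
  then show "x \<in> (g <# H) #> inv g"
    using x unfolding l_coset_def r_coset_def by blast
qed

text \<open>The stabilisers are conjugates of the \<open>\<Gamma> n\<close>. Coherence of
  \<open>b\<close> makes consecutive stabilisers conjugates by a common element, which keeps the
  inclusions strict, and conjugation does not affect the normal core.\<close>

lemma odometer_sequence_stabilizers: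
  assumes \<Gamma>: "odometer_sequence G \<Gamma>"
    and b: "\<And>n. b n \<in> lcosets (\<Gamma> n)" "\<And>n. b n = b (Suc n) <#> \<Gamma> n"
  shows "odometer_sequence G (\<lambda>n. {g \<in> carrier G. g <# b n = b n})"
proof -
  let ?S = "\<lambda>n. {g \<in> carrier G. g <# b n = b n}"
  have fi: "finite_index_subgroup G (\<Gamma> n)" and dec: "\<Gamma> (Suc n) \<subset> \<Gamma> n" for n
    using \<Gamma> unfolding odometer_sequence_def by auto
  have sg: "subgroup (\<Gamma> n) G" for n using fi unfolding finite_index_subgroup_def by simp
  have strict: "?S (Suc n) \<subset> ?S n" for n
  proof -
    obtain a where a: "a \<in> carrier G" "b (Suc n) = a <# \<Gamma> (Suc n)"
      using b(1)[of "Suc n"] unfolding LCOSETS_def by auto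
    \<comment> \<open>The representative \<open>a\<close> of \<open>b (Suc n)\<close> also
      represents \<open>b n\<close>, so one conjugation serves both indices.\<close>
    have bn: "b n = a <# \<Gamma> n"
      using b(2)[of n] lcoset_mult_subgroup[OF sg sg _ a(1)] dec[of n] unfolding a(2) by auto
    have iff: "g \<in> ?S n \<longleftrightarrow> g \<in> carrier G \<and> inv a \<otimes> g \<otimes> a \<in> \<Gamma> n"
      "g \<in> ?S (Suc n) \<longleftrightarrow> g \<in> carrier G \<and> inv a \<otimes> g \<otimes> a \<in> \<Gamma> (Suc n)" for g
      using lcoset_stabilizer_iff[OF sg a(1)] unfolding bn a(2) by auto
    obtain k where k: "k \<in> \<Gamma> n" "k \<notin> \<Gamma> (Suc n)" using dec[of n] by blast
    have kc: "k \<in> carrier G" using k(1) subgroup.subset[OF sg] by blast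
    have "inv a \<otimes> (a \<otimes> k \<otimes> inv a) \<otimes> a = k"
      using a(1) kc by (simp add: m_assoc) (simp flip: m_assoc)
    then have "a \<otimes> k \<otimes> inv a \<in> ?S n" "a \<otimes> k \<otimes> inv a \<notin> ?S (Suc n)"
      unfolding iff using k kc a(1) by auto
    moreover have "?S (Suc n) \<subseteq> ?S n" using iff dec[of n] by blast
    ultimately show ?thesis by blast
  qed
  \<comment> \<open>Conjugating the stabiliser by \<open>g\<close> is conjugating
    \<open>\<Gamma> n\<close> by \<open>g \<otimes> a\<close>, and \<open>g \<otimes> a\<close> runs
    through the whole group together with \<open>g\<close>.\<close>
  have int: "(\<Inter>g\<in>carrier G. (g <# ?S n) #> inv g) = (\<Inter>g\<in>carrier G. (g <# \<Gamma> n) #> inv g)" for n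
  proof -
    obtain a where a: "a \<in> carrier G" "b n = a <# \<Gamma> n"
      using b(1)[of n] unfolding LCOSETS_def by auto
    have S: "?S n = {y \<in> carrier G. inv a \<otimes> y \<otimes> a \<in> \<Gamma> n}"
      unfolding a(2) using lcoset_stabilizer_iff[OF sg a(1)] by (intro Collect_cong conj_cong refl)
    have *: "x \<in> (g <# ?S n) #> inv g \<longleftrightarrow> x \<in> ((g \<otimes> a) <# \<Gamma> n) #> inv (g \<otimes> a)"
      if g: "g \<in> carrier G" for g x
    proof -
      have "x \<in> (g <# ?S n) #> inv g \<longleftrightarrow> x \<in> carrier G \<and> inv a \<otimes> (inv g \<otimes> x \<otimes> g) \<otimes> a \<in> \<Gamma> n"
        using mem_conjugate_iff[of "?S n" g x] g unfolding S by auto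
      also have "\<dots> \<longleftrightarrow> x \<in> carrier G \<and> inv (g \<otimes> a) \<otimes> x \<otimes> (g \<otimes> a) \<in> \<Gamma> n"
        using a g by (auto simp: inv_mult_group m_assoc)
      also have "\<dots> \<longleftrightarrow> x \<in> ((g \<otimes> a) <# \<Gamma> n) #> inv (g \<otimes> a)"
        using mem_conjugate_iff[of "\<Gamma> n" "g \<otimes> a" x] a g subgroup.subset[OF sg] by simp
      finally show ?thesis .
    qed
    have bij: "\<exists>g'\<in>carrier G. g = g' \<otimes> a" if "g \<in> carrier G" for g
      using that a by (intro bexI[of _ "g \<otimes> inv a"]) (auto simp: m_assoc)
    have "x \<in> (\<Inter>g\<in>carrier G. (g <# ?S n) #> inv g) \<longleftrightarrow> x \<in> (\<Inter>g\<in>carrier G. (g <# \<Gamma> n) #> inv g)" for x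
      using * bij a(1) by simp (metis m_closed)
    then show ?thesis by blast
  qed
  show ?thesis
    unfolding odometer_sequence_def
  proof (intro conjI allI)
    show "finite_index_subgroup G (?S n)" for n
      by (rule finite_index_stabilizer[OF fi b(1)])
    show "?S (Suc n) \<subset> ?S n" for n by (rule strict)
    show "(\<Inter>n. \<Inter>g\<in>carrier G. (g <# ?S n) #> inv g) = {\<one>}"
      unfolding int using \<Gamma> unfolding odometer_sequence_def by simp
  qed
qed

end

section \<open>The odometer space and measurable maps into it\<close>

locale odometer = group G for G :: "('a, 'b) monoid_scheme" (structure) +
  fixes \<Gamma> :: "nat \<Rightarrow> 'a set"
  assumes odometer: "odometer_sequence G \<Gamma>"
begin

lemma subgroup_\<Gamma>: "subgroup (\<Gamma> n) G" and finite_lcosets_\<Gamma>: "finite (lcosets (\<Gamma> n))"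
  and \<Gamma>_Suc: "\<Gamma> (Suc n) \<subset> \<Gamma> n"
  using odometer unfolding odometer_sequence_def finite_index_subgroup_def by auto

lemma \<Gamma>_mono: "m \<le> n \<Longrightarrow> \<Gamma> n \<subseteq> \<Gamma> m"
  by (rule lift_Suc_antimono_le[of \<Gamma>]) (rule psubset_imp_subset[OF \<Gamma>_Suc])

lemma lcoset_project: "a \<in> carrier G \<Longrightarrow> m \<le> n \<Longrightarrow> (a <# \<Gamma> n) <#> \<Gamma> m = a <# \<Gamma> m"
  by (intro lcoset_mult_subgroup subgroup_\<Gamma> \<Gamma>_mono)

lemma lcosets_project:
  assumes "A \<in> lcosets (\<Gamma> n)" "m \<le> n"
  shows "A <#> \<Gamma> m \<in> lcosets (\<Gamma> m)"
  using assms lcoset_project unfolding LCOSETS_def by auto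

lemma lcosets_project_project:
  assumes A: "A \<in> lcosets (\<Gamma> n)" and "k \<le> m" "m \<le> n"
  shows "(A <#> \<Gamma> m) <#> \<Gamma> k = A <#> \<Gamma> k"
proof -
  obtain a where "a \<in> carrier G" "A = a <# \<Gamma> n"
    using A unfolding LCOSETS_def by auto
  then show ?thesis
    using assms lcoset_project by simp
qed

lemma odometer_space_iff:
  "y \<in> odometer_space G \<Gamma> \<longleftrightarrow> (\<forall>n. y n \<in> lcosets (\<Gamma> n)) \<and> (\<forall>n. y n = y (Suc n) <#> \<Gamma> n)"
  unfolding odometer_space_def by (auto simp: PiE_def Pi_def)

text \<open>The defining compatibility concerns neighbouring indices only; composing the bonding
  maps extends it to all pairs.\<close>

lemma odometer_space_project:
  assumes y: "y \<in> odometer_space G \<Gamma>" and "m \<le> n"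
  shows "y m = y n <#> \<Gamma> m"
  using \<open>m \<le> n\<close>
proof (induction m rule: inc_induct)
  case base
  then show ?case
    using y lcoset_project[of _ n n] unfolding odometer_space_iff LCOSETS_def
    by (metis (no_types, lifting) UN_E order_refl singletonD)
next
  case (step m)
  have "y m = y (Suc m) <#> \<Gamma> m" using y unfolding odometer_space_iff by blast
  also have "\<dots> = (y n <#> \<Gamma> (Suc m)) <#> \<Gamma> m" using step by simp
  also have "\<dots> = y n <#> \<Gamma> m"
  proof (rule lcosets_project_project)
    show "y n \<in> lcosets (\<Gamma> n)" using y unfolding odometer_space_iff by blast
  qed (use step in simp_all)
  finally show ?case .
qed

lemma topspace_odometer: "topspace (odometer_topology G \<Gamma>) = odometer_space G \<Gamma>"
proof -
  have "odometer_space G \<Gamma> \<subseteq> topspace (product_topology (\<lambda>n. discrete_topology (lcosets (\<Gamma> n))) UNIV)"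
    unfolding odometer_space_def by auto
  then show ?thesis
    unfolding odometer_topology_def by (rule topspace_subtopology_subset)
qed

lemma openin_coordinate:
  assumes "A \<in> lcosets (\<Gamma> n)"
  shows "openin (odometer_topology G \<Gamma>) {y \<in> odometer_space G \<Gamma>. y n = A}"
proof -
  let ?T = "product_topology (\<lambda>n. discrete_topology (lcosets (\<Gamma> n))) UNIV"
  have "openin ?T {y \<in> topspace ?T. y n \<in> {A}}"
    by (rule openin_continuous_map_preimage[OF continuous_map_product_projection[of n UNIV]])
       (use assms in auto)
  then have "openin (odometer_topology G \<Gamma>) ({y \<in> topspace ?T. y n \<in> {A}} \<inter> odometer_space G \<Gamma>)"
    unfolding odometer_topology_def by (auto simp: openin_subtopology)
  moreover have "{y \<in> topspace ?T. y n \<in> {A}} \<inter> odometer_space G \<Gamma> = {y \<in> odometer_space G \<Gamma>. y n = A}"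
    unfolding odometer_space_def by auto
  ultimately show ?thesis by simp
qed

text \<open>A basic open set constrains finitely many coordinates, and the last of these determines
  all earlier ones.\<close>

lemma open_union_coordinates:
  assumes "openin (odometer_topology G \<Gamma>) U" "y \<in> U"
  shows "\<exists>n. {y' \<in> odometer_space G \<Gamma>. y' n = y n} \<subseteq> U"
proof -
  let ?T = "\<lambda>n. discrete_topology (lcosets (\<Gamma> n))"
  obtain S where S: "openin (product_topology ?T UNIV) S" "U = S \<inter> odometer_space G \<Gamma>"
    using assms(1) unfolding odometer_topology_def by (auto simp: openin_subtopology)
  have yS: "y \<in> S" "y \<in> odometer_space G \<Gamma>" using assms(2) S(2) by auto
  obtain X where X: "y \<in> Pi\<^sub>E UNIV X" "finite {i. X i \<noteq> lcosets (\<Gamma> i)}" "Pi\<^sub>E UNIV X \<subseteq> S"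
    using product_topology_open_contains_basis[OF S(1) yS(1)] by auto
  obtain n where n: "\<forall>i\<in>{i. X i \<noteq> lcosets (\<Gamma> i)}. i \<le> n"
    using X(2) finite_nat_set_iff_bounded_le by blast
  have "y' \<in> U" if y': "y' \<in> odometer_space G \<Gamma>" "y' n = y n" for y'
  proof -
    have "y' i \<in> X i" for i
    proof (cases "i \<le> n")
      case True
      then have "y' i = y i"
        using odometer_space_project[OF y'(1)] odometer_space_project[OF yS(2)] y'(2) by simp
      then show ?thesis using X(1) by auto
    next
      case False
      then have "X i = lcosets (\<Gamma> i)" using n by blast
      moreover have "y' i \<in> lcosets (\<Gamma> i)" using y'(1) unfolding odometer_space_iff by blast
      ultimately show ?thesis by simp
    qed
    then show ?thesis using X(3) S(2) y'(1) by auto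
  qed
  then show ?thesis by blast
qed

text \<open>The sets that prescribe one coordinate form a base, and it is countable because every
  \<open>\<Gamma> n\<close> has finite index.\<close>

lemma measurable_odometer:
  assumes \<phi>: "\<And>p. p \<in> space M \<Longrightarrow> \<phi> p \<in> odometer_space G \<Gamma>"
    and meas: "\<And>n A. A \<in> lcosets (\<Gamma> n) \<Longrightarrow> {p \<in> space M. \<phi> p n = A} \<in> sets M"
  shows "\<phi> \<in> measurable M (borel_on (odometer_topology G \<Gamma>))"
proof (rule measurable_sigma_sets[OF sets_borel_on])
  show "{U. openin (odometer_topology G \<Gamma>) U} \<subseteq> Pow (topspace (odometer_topology G \<Gamma>))"
    by (auto dest: openin_subset)
  show "\<phi> \<in> space M \<rightarrow> topspace (odometer_topology G \<Gamma>)"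
    using \<phi> by (auto simp: topspace_odometer)
  fix U assume "U \<in> {U. openin (odometer_topology G \<Gamma>) U}"
  then have U: "openin (odometer_topology G \<Gamma>) U" by simp
  let ?J = "{(n, A). A \<in> lcosets (\<Gamma> n) \<and> {y \<in> odometer_space G \<Gamma>. y n = A} \<subseteq> U}"
  have "?J \<subseteq> (SIGMA n:UNIV. lcosets (\<Gamma> n))" by auto
  then have J: "countable ?J"
    by (rule countable_subset) (auto intro: countable_finite finite_lcosets_\<Gamma>)
  have "\<phi> -` U \<inter> space M = (\<Union>(n, A)\<in>?J. {p \<in> space M. \<phi> p n = A})"
  proof (intro equalityI subsetI)
    fix p assume p: "p \<in> \<phi> -` U \<inter> space M"
    then obtain n where "{y' \<in> odometer_space G \<Gamma>. y' n = \<phi> p n} \<subseteq> U"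
      using open_union_coordinates[OF U] by blast
    moreover have "\<phi> p n \<in> lcosets (\<Gamma> n)"
      using \<phi> p odometer_space_iff by blast
    ultimately show "p \<in> (\<Union>(n, A)\<in>?J. {p \<in> space M. \<phi> p n = A})"
      using p by auto
  qed (use \<phi> in auto)
  also have "\<dots> \<in> sets M"
    by (rule sets.countable_UN'[OF J]) (use meas in auto)
  finally show "\<phi> -` U \<inter> space M \<in> sets M" .
qed

lemma measurable_coordinate:
  assumes \<phi>: "\<phi> \<in> measurable M (borel_on (odometer_topology G \<Gamma>))" and A: "A \<in> lcosets (\<Gamma> n)"
  shows "{p \<in> space M. \<phi> p n = A} \<in> sets M"
proof -
  have "{y \<in> odometer_space G \<Gamma>. y n = A} \<in> sets (borel_on (odometer_topology G \<Gamma>))"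
    unfolding sets_borel_on using openin_coordinate[OF A] by (auto intro: sigma_sets.Basic)
  from measurable_sets[OF \<phi> this]
  have "\<phi> -` {y \<in> odometer_space G \<Gamma>. y n = A} \<inter> space M \<in> sets M" .
  moreover have "\<phi> p \<in> odometer_space G \<Gamma>" if "p \<in> space M" for p
    using measurable_space[OF \<phi> that] by (simp add: space_borel_on topspace_odometer)
  then have "\<phi> -` {y \<in> odometer_space G \<Gamma>. y n = A} \<inter> space M = {p \<in> space M. \<phi> p n = A}"
    by auto
  ultimately show ?thesis by simp
qed

end

section \<open>Deeper cylinders of a point and the law of a block\<close>

lemma (in CF_parameters) cyl_deeper:
  assumes "p \<in> cyl n f" "n \<le> m"
  obtains d where "d \<in> word n m" "f \<otimes> d \<in> F m" "p \<in> cyl m (f \<otimes> d)"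
proof -
  have f: "f \<in> F n" using assms(1) cyl_nonmem by blast
  show ?thesis
    using assms(1) that F_word_closed[OF assms(2) f] unfolding cyl_split[OF assms(2) f] by blast
qed

lemma (in CF_parameters) cyl_unique: "p \<in> cyl n f \<Longrightarrow> p \<in> cyl n f' \<Longrightarrow> f = f'"
  using cyl_disjoint by blast

text \<open>The link between \<open>\<mu>\<close> and the convolutions: inside any cylinder of level
  \<open>p\<close> the block up to level \<open>q\<close> has law \<open>conv p q\<close>, whatever
  the first coordinate \<open>f\<close>.\<close>

lemma (in CF_system) emeasure_block:
  assumes pq: "p \<le> q" and f: "f \<in> F p" and S: "S \<subseteq> word p q"
  shows "emeasure \<mu> (\<Union>c\<in>S. cyl q (f \<otimes> c)) = wt p f * emeasure (measure_pmf (conv p q)) S"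
proof -
  have fin: "finite S" using S finite_word[OF pq] finite_subset by blast
  have inj: "inj_on (\<lambda>c. f \<otimes> c) S"
    using F_word_cancel[OF pq f f] S by (intro inj_onI) blast
  have "emeasure \<mu> (\<Union>c\<in>S. cyl q (f \<otimes> c)) = emeasure \<mu> (\<Union>h\<in>(\<lambda>c. f \<otimes> c) ` S. cyl q h)"
    by simp
  also have "\<dots> = ennreal (\<Sum>h\<in>(\<lambda>c. f \<otimes> c) ` S. wt q h)"
    using F_word_closed[OF pq f] S by (intro emeasure_Union_cyl) blast
  also have "(\<Sum>h\<in>(\<lambda>c. f \<otimes> c) ` S. wt q h) = (\<Sum>c\<in>S. wt p f * pmf (conv p q) c)"
    unfolding sum.reindex[OF inj] using wt_word[OF pq f] S by (intro sum.cong) auto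
  also have "ennreal \<dots> = wt p f * ennreal (\<Sum>c\<in>S. pmf (conv p q) c)"
    by (simp add: sum_distrib_left[symmetric] ennreal_mult' sum_nonneg)
  also have "ennreal (\<Sum>c\<in>S. pmf (conv p q) c) = emeasure (measure_pmf (conv p q)) S"
    by (rule emeasure_measure_pmf_finite[symmetric, OF fin])
  finally show ?thesis .
qed

subsection \<open>From a compatible telescoping to an odometer factor\<close>

locale CF_odometer = CF_system G C F \<kappa> \<nu> \<mu> + odometer G \<Gamma>
  for G :: "('a, 'b) monoid_scheme" (structure) and C F \<kappa> \<nu> \<mu> \<Gamma>

locale CF_compatible = CF_odometer G C F \<kappa> \<nu> \<mu> \<Gamma>
  for G :: "('a, 'b) monoid_scheme" (structure) and C F \<kappa> \<nu> \<mu> \<Gamma> +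
  fixes q :: "nat \<Rightarrow> nat"
  assumes q_mono: "strict_mono q"
    and compatible: "(\<Sum>n. emeasure (measure_pmf (conv (q n) (q (Suc n))))
      {c \<in> word (q n) (q (Suc n)). c \<notin> \<Gamma> n}) \<noteq> \<infinity>"
begin

abbreviation "bad n \<equiv> {c \<in> word (q n) (q (Suc n)). c \<notin> \<Gamma> n}"

text \<open>The points present at level \<open>q n\<close> whose block up to level
  \<open>q (Suc n)\<close> leaves \<open>\<Gamma> n\<close>. A point that enters the increasing
  union only later is not counted.\<close>

definition bad_event :: "nat \<Rightarrow> (nat \<times> (nat \<Rightarrow> 'a)) set set" where
  "bad_event n = (\<Union>f\<in>F (q n). \<Union>c\<in>bad n. cyl (q (Suc n)) (f \<otimes> c))"

lemma q_le: "m \<le> n \<Longrightarrow> q m \<le> q n"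
  using q_mono by (simp add: strict_mono_less_eq)

lemma le_q: "n \<le> q n"
  using q_mono by (rule strict_mono_imp_increasing)

lemma sets_bad_event [measurable]: "bad_event n \<in> sets \<mu>"
  unfolding bad_event_def using F_finite finite_word[OF q_le, of n "Suc n"]
  by (intro sets.finite_UN) auto

text \<open>The block after level \<open>q n\<close> is independent of the coordinates before it.
  Splitting the cylinder along its blocks up to level \<open>q n\<close> therefore gives every piece
  the same relative measure of bad points.\<close>

lemma emeasure_bad_event:
  assumes N: "N \<le> n" and f: "f \<in> F (q N)"
  shows "emeasure \<mu> (cyl (q N) f \<inter> bad_event n) \<le>
    ennreal (wt (q N) f * measure_pmf.prob (conv (q n) (q (Suc n))) (bad n))"
proof -
  let ?P = "emeasure (measure_pmf (conv (q n) (q (Suc n)))) (bad n)"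
  let ?W = "word (q N) (q n)"
  have Nn: "q N \<le> q n" and nS: "q n \<le> q (Suc n)" using q_le N by auto
  have fd: "f \<otimes> d \<in> F (q n)" if "d \<in> ?W" for d using F_word_closed[OF Nn f that] .
  have "cyl (q N) f \<inter> bad_event n \<subseteq> (\<Union>d\<in>?W. \<Union>c\<in>bad n. cyl (q (Suc n)) (f \<otimes> d \<otimes> c))"
  proof
    fix p assume p: "p \<in> cyl (q N) f \<inter> bad_event n"
    then obtain h c where hc: "h \<in> F (q n)" "c \<in> bad n" "p \<in> cyl (q (Suc n)) (h \<otimes> c)"
      unfolding bad_event_def by blast
    have "p \<in> cyl (q n) h"
      unfolding cyl_split[OF nS hc(1)] using hc by blast
    moreover obtain d where d: "d \<in> ?W" "p \<in> cyl (q n) (f \<otimes> d)"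
      using p by (blast elim: cyl_deeper[OF _ Nn])
    ultimately have "h = f \<otimes> d" using cyl_unique by blast
    then show "p \<in> (\<Union>d\<in>?W. \<Union>c\<in>bad n. cyl (q (Suc n)) (f \<otimes> d \<otimes> c))"
      using d hc by blast
  qed
  then have "emeasure \<mu> (cyl (q N) f \<inter> bad_event n) \<le>
      emeasure \<mu> (\<Union>d\<in>?W. \<Union>c\<in>bad n. cyl (q (Suc n)) (f \<otimes> d \<otimes> c))"
    using finite_word[OF Nn] finite_word[OF nS] by (intro emeasure_mono sets.finite_UN) auto
  also have "\<dots> \<le> (\<Sum>d\<in>?W. emeasure \<mu> (\<Union>c\<in>bad n. cyl (q (Suc n)) (f \<otimes> d \<otimes> c)))"
    using finite_word[OF Nn] finite_word[OF nS]
    by (intro emeasure_subadditive_finite) (auto intro!: sets.finite_UN)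
  also have "\<dots> = (\<Sum>d\<in>?W. ennreal (wt (q n) (f \<otimes> d)) * ?P)"
    using emeasure_block[OF nS fd] by (intro sum.cong) auto
  also have "\<dots> = (\<Sum>d\<in>?W. ennreal (wt (q N) f) * ennreal (pmf (conv (q N) (q n)) d)) * ?P"
    unfolding sum_distrib_right using wt_word[OF Nn f] by (intro sum.cong) (auto simp: ennreal_mult')
  also have "(\<Sum>d\<in>?W. ennreal (wt (q N) f) * ennreal (pmf (conv (q N) (q n)) d)) =
      ennreal (wt (q N) f) * emeasure (measure_pmf (conv (q N) (q n))) ?W"
    using emeasure_measure_pmf_finite[OF finite_word[OF Nn]]
    by (simp add: sum_distrib_left[symmetric] sum_ennreal)
  also have "\<dots> \<le> ennreal (wt (q N) f) * 1"
    by (intro mult_left_mono measure_pmf.emeasure_le_1) simp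
  finally show ?thesis
    by (simp add: measure_pmf.emeasure_eq_measure ennreal_mult' mult_right_mono)
qed

text \<open>Borel--Cantelli is applied inside one cylinder at a time, where the measures of the bad
  events are finite and summable; countably many cylinders cover the space.\<close>

lemma AE_not_bad_event: "AE p in \<mu>. \<forall>\<^sub>F n in sequentially. p \<notin> bad_event n"
proof -
  have "(\<Sum>n. ennreal (measure_pmf.prob (conv (q n) (q (Suc n))) (bad n))) \<noteq> \<infinity>"
    using compatible by (simp add: measure_pmf.emeasure_eq_measure)
  then have sm: "summable (\<lambda>n. measure_pmf.prob (conv (q n) (q (Suc n))) (bad n))"
    by (intro summable_suminf_not_top) simp_all
  have cyl_case: "AE p in \<mu>. p \<in> cyl (q N) f \<longrightarrow> (\<forall>\<^sub>F n in sequentially. p \<notin> bad_event n)"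
    if f: "f \<in> F (q N)" for N f
  proof -
    \<comment> \<open>The index is shifted by \<open>N\<close> because the bound on bad events
      inside a level \<open>q N\<close> cylinder starts at \<open>n = N\<close>.\<close>
    let ?A = "\<lambda>k. cyl (q N) f \<inter> bad_event (k + N)"
    let ?r = "\<lambda>k. wt (q N) f * measure_pmf.prob (conv (q (k + N)) (q (Suc (k + N)))) (bad (k + N))"
    have le: "emeasure \<mu> (?A k) \<le> ennreal (?r k)" for k
      using emeasure_bad_event[OF _ f, of "k + N"] by simp
    have "AE p in \<mu>. \<forall>\<^sub>F k in sequentially. p \<in> space \<mu> - ?A k"
    proof (rule borel_cantelli_AE1)
      show "?A k \<in> sets \<mu>" for k by measurable
      show "emeasure \<mu> (?A k) < \<infinity>" for k
        using le[of k] by (rule le_less_trans) simp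
      show "summable (\<lambda>k. measure \<mu> (?A k))"
      proof (rule summable_comparison_test'[where N = 0])
        show "summable ?r"
          by (intro summable_mult summable_ignore_initial_segment sm)
        show "norm (measure \<mu> (?A k)) \<le> ?r k" for k
          using le[of k] by (simp add: measure_def enn2real_leI)
      qed
    qed
    then show ?thesis
    proof (rule AE_mp, intro AE_I2 impI)
      fix p assume "\<forall>\<^sub>F k in sequentially. p \<in> space \<mu> - ?A k" "p \<in> cyl (q N) f"
      then have "\<forall>\<^sub>F k in sequentially. p \<notin> bad_event (k + N)"
        by (elim eventually_mono) auto
      then show "\<forall>\<^sub>F n in sequentially. p \<notin> bad_event n"
        by (subst (asm) eventually_sequentially_seg)
    qed
  qed
  have "AE p in \<mu>. \<forall>N. \<forall>f\<in>F (q N). p \<in> cyl (q N) f \<longrightarrow> (\<forall>\<^sub>F n in sequentially. p \<notin> bad_event n)"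
    by (intro AE_all_countable[THEN iffD2] allI AE_finite_allI F_finite) (rule cyl_case)
  then show ?thesis
  proof (rule AE_mp, intro AE_I2 impI)
    fix p assume p: "p \<in> space \<mu>"
      "\<forall>N. \<forall>f\<in>F (q N). p \<in> cyl (q N) f \<longrightarrow> (\<forall>\<^sub>F n in sequentially. p \<notin> bad_event n)"
    obtain n f where "p \<in> cyl n f" using p(1) unfolding space_\<mu> CF_space_eq_cyl by blast
    then obtain d where "f \<otimes> d \<in> F (q n)" "p \<in> cyl (q n) (f \<otimes> d)"
      using cyl_deeper[OF _ le_q] by blast
    then show "\<forall>\<^sub>F n in sequentially. p \<notin> bad_event n" using p(2) by blast
  qed
qed

text \<open>The first coordinates of \<open>p\<close> at the levels \<open>q N\<close> eventually
  stay in the coset \<open>A\<close> of \<open>\<Gamma> n\<close>, so \<open>A\<close> is their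
  limit.\<close>

definition settles :: "nat \<Rightarrow> 'a set \<Rightarrow> (nat \<times> (nat \<Rightarrow> 'a)) set \<Rightarrow> bool" where
  "settles n A p \<longleftrightarrow> (\<exists>N0. \<forall>N\<ge>N0. \<exists>f\<in>F (q N). p \<in> cyl (q N) f \<and> f <# \<Gamma> n = A)"

lemma settles_unique:
  assumes "settles n A p" "settles n A' p"
  shows "A = A'"
proof -
  obtain N0 N0' where "\<forall>N\<ge>N0. \<exists>f\<in>F (q N). p \<in> cyl (q N) f \<and> f <# \<Gamma> n = A"
    "\<forall>N\<ge>N0'. \<exists>f\<in>F (q N). p \<in> cyl (q N) f \<and> f <# \<Gamma> n = A'"
    using assms unfolding settles_def by blast
  then have "\<exists>f\<in>F (q (max N0 N0')). p \<in> cyl (q (max N0 N0')) f \<and> f <# \<Gamma> n = A"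
    "\<exists>f\<in>F (q (max N0 N0')). p \<in> cyl (q (max N0 N0')) f \<and> f <# \<Gamma> n = A'"
    by simp_all
  then show ?thesis using cyl_unique by metis
qed

lemma settles_project:
  assumes "settles (Suc n) A p"
  shows "settles n (A <#> \<Gamma> n) p"
proof -
  obtain N0 where N0: "\<forall>N\<ge>N0. \<exists>f\<in>F (q N). p \<in> cyl (q N) f \<and> f <# \<Gamma> (Suc n) = A"
    using assms unfolding settles_def by blast
  have "\<exists>f\<in>F (q N). p \<in> cyl (q N) f \<and> f <# \<Gamma> n = A <#> \<Gamma> n" if "N \<ge> N0" for N
    using N0 that lcoset_project[of _ n "Suc n"] F_closed by (metis le_add2 plus_1_eq_Suc)
  then show ?thesis unfolding settles_def by blast
qed

text \<open>Once a level is reached at which \<open>g\<close> acts on \<open>p\<close> through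
  \<open>f0\<close>, every later first coordinate \<open>f0 \<otimes> d\<close> just becomes
  \<open>g \<otimes> f0 \<otimes> d\<close>.\<close>

lemma settles_act:
  assumes p: "settles n A p" and g: "g \<in> carrier G" and dom: "p \<in> CF_dom G C F g"
  shows "settles n (g <# A) (act g p)"
proof -
  obtain N0 where N0: "\<forall>N\<ge>N0. \<exists>f\<in>F (q N). p \<in> cyl (q N) f \<and> f <# \<Gamma> n = A"
    using p unfolding settles_def by blast
  obtain m f0 where f0: "f0 \<in> F m" "g \<otimes> f0 \<in> F m" "p \<in> cyl m f0"
    using dom unfolding CF_dom_eq_cyl by blast
  have "\<exists>f\<in>F (q N). act g p \<in> cyl (q N) f \<and> f <# \<Gamma> n = g <# A" if N: "N \<ge> max N0 m" for N
  proof -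
    have mN: "m \<le> q N" using N le_q[of N] by simp
    obtain d where d: "d \<in> word m (q N)" "f0 \<otimes> d \<in> F (q N)" "p \<in> cyl (q N) (f0 \<otimes> d)"
      by (rule cyl_deeper[OF f0(3) mN])
    obtain f where "f \<in> F (q N)" "p \<in> cyl (q N) f" "f <# \<Gamma> n = A"
      using N0 N by auto
    then have A: "(f0 \<otimes> d) <# \<Gamma> n = A" using d(3) cyl_unique by blast
    have as: "g \<otimes> (f0 \<otimes> d) = g \<otimes> f0 \<otimes> d"
      using g f0(1) d(1) F_closed word_closed by (simp add: m_assoc)
    then have gF: "g \<otimes> (f0 \<otimes> d) \<in> F (q N)"
      using F_word_closed[OF mN f0(2) d(1)] by simp
    have "(g \<otimes> (f0 \<otimes> d)) <# \<Gamma> n = g <# A"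
      unfolding A[symmetric] by (rule lcos_m_assoc[OF subgroup.subset[OF subgroup_\<Gamma>] g F_closed[OF d(2)], symmetric])
    then show ?thesis
      using CF_action_cyl[OF d(3) g gF] gF by blast
  qed
  then show ?thesis unfolding settles_def by blast
qed

lemma AE_settles: "AE p in \<mu>. \<forall>n. \<exists>A\<in>lcosets (\<Gamma> n). settles n A p"
  using AE_not_bad_event
proof (rule AE_mp, intro AE_I2 impI allI)
  fix p n assume p: "p \<in> space \<mu>" "\<forall>\<^sub>F n in sequentially. p \<notin> bad_event n"
  obtain M where M: "\<And>N. N \<ge> M \<Longrightarrow> p \<notin> bad_event N"
    using p(2) unfolding eventually_sequentially by blast
  obtain m f0 where f0: "p \<in> cyl m f0" using p(1) unfolding space_\<mu> CF_space_eq_cyl by blast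
  \<comment> \<open>Beyond \<open>K\<close> there are no bad events, the block lies in
    \<open>\<Gamma> N\<close> and hence in \<open>\<Gamma> n\<close>, and \<open>p\<close> is
    present at level \<open>q K\<close>. Right multiplication by such a block fixes the
    coset.\<close>
  define K where "K = max (max M n) m"
  have "m \<le> q K" using le_q[of K] by (simp add: K_def)
  then obtain f where f: "f \<in> F (q K)" "p \<in> cyl (q K) f"
    using cyl_deeper[OF f0] by blast
  have "\<exists>f'\<in>F (q N). p \<in> cyl (q N) f' \<and> f' <# \<Gamma> n = f <# \<Gamma> n" if "N \<ge> K" for N
    using that
  proof (induction N rule: dec_induct)
    case base
    then show ?case using f by blast
  next
    case (step N)
    then obtain f' where f': "f' \<in> F (q N)" "p \<in> cyl (q N) f'" "f' <# \<Gamma> n = f <# \<Gamma> n" by blast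
    obtain c where c: "c \<in> word (q N) (q (Suc N))" "f' \<otimes> c \<in> F (q (Suc N))"
      "p \<in> cyl (q (Suc N)) (f' \<otimes> c)"
      by (rule cyl_deeper[OF f'(2) q_le[of N "Suc N"]]) auto
    have "p \<notin> bad_event N" using M step by (simp add: K_def)
    then have "c \<in> \<Gamma> N" using c f' unfolding bad_event_def by blast
    then have "c \<in> \<Gamma> n" using \<Gamma>_mono[of n N] step by (auto simp: K_def)
    then have "c <# \<Gamma> n = \<Gamma> n"
      using coset_join3[OF word_closed[OF c(1)] subgroup_\<Gamma>] by blast
    then have "(f' \<otimes> c) <# \<Gamma> n = f <# \<Gamma> n"
      using lcos_m_assoc[OF subgroup.subset[OF subgroup_\<Gamma>] F_closed[OF f'(1)] word_closed[OF c(1)], of n] f'(3)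
      by metis
    then show ?case using c by blast
  qed
  then have "settles n (f <# \<Gamma> n) p" unfolding settles_def by blast
  moreover have "f <# \<Gamma> n \<in> lcosets (\<Gamma> n)"
    using F_closed[OF f(1)] unfolding LCOSETS_def by blast
  ultimately show "\<exists>A\<in>lcosets (\<Gamma> n). settles n A p" by blast
qed

lemma sets_settles [measurable]: "{p \<in> space \<mu>. settles n A p} \<in> sets \<mu>"
proof -
  have "{p \<in> space \<mu>. settles n A p} =
      (\<Union>N0. \<Inter>N\<in>{N0..}. \<Union>f\<in>{f \<in> F (q N). f <# \<Gamma> n = A}. cyl (q N) f)" (is "_ = ?R")
  proof (rule Set.set_eqI)
    fix p
    have "p \<in> space \<mu>" if "settles n A p"
      using that cyl_subset_space unfolding settles_def space_\<mu> by blast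
    moreover have "p \<in> ?R \<longleftrightarrow> settles n A p"
      unfolding settles_def UN_iff INT_iff Ball_def Bex_def atLeast_iff mem_Collect_eq
      by (simp add: conj_ac)
    ultimately show "p \<in> {p \<in> space \<mu>. settles n A p} \<longleftrightarrow> p \<in> ?R" by blast
  qed
  also have "?R \<in> sets \<mu>"
  proof -
    have "(\<Union>f\<in>{f \<in> F (q N). f <# \<Gamma> n = A}. cyl (q N) f) \<in> sets \<mu>" for N
      using F_finite by (intro sets.finite_UN) auto
    then have "(\<Inter>N\<in>{N0..}. \<Union>f\<in>{f \<in> F (q N). f <# \<Gamma> n = A}. cyl (q N) f) \<in> sets \<mu>" for N0
      by (intro sets.countable_INT' image_subsetI) simp_all
    then show ?thesis by (intro sets.countable_UN image_subsetI)
  qed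
  finally show ?thesis .
qed

text \<open>On the null set where some limit is missing the value is \<open>\<Gamma>\<close>, the
  sequence of identity cosets, so that the map takes values in the odometer everywhere.\<close>

definition limit_map :: "(nat \<times> (nat \<Rightarrow> 'a)) set \<Rightarrow> nat \<Rightarrow> 'a set" where
  "limit_map p = (if \<forall>n. \<exists>A\<in>lcosets (\<Gamma> n). settles n A p then \<lambda>n. THE A. settles n A p else \<Gamma>)"

lemma limit_map_eq:
  assumes "\<forall>n. \<exists>A\<in>lcosets (\<Gamma> n). settles n A p"
  shows "limit_map p n \<in> lcosets (\<Gamma> n)" "settles n (limit_map p n) p"
proof -
  obtain A where A: "A \<in> lcosets (\<Gamma> n)" "settles n A p" using assms by blast
  have "limit_map p n = A"
    unfolding limit_map_def if_P[OF assms]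
    by (rule the_equality) (use A(2) settles_unique in blast)+
  then show "limit_map p n \<in> lcosets (\<Gamma> n)" "settles n (limit_map p n) p"
    using A by auto
qed

lemma \<Gamma>_in_lcosets: "\<Gamma> n \<in> lcosets (\<Gamma> n)"
  using lcos_mult_one[OF subgroup.subset[OF subgroup_\<Gamma>]] unfolding LCOSETS_def by auto

lemma limit_map_in_space: "limit_map p \<in> odometer_space G \<Gamma>"
proof (cases "\<forall>n. \<exists>A\<in>lcosets (\<Gamma> n). settles n A p")
  case True
  have "limit_map p n = limit_map p (Suc n) <#> \<Gamma> n" for n
    using limit_map_eq(2)[OF True] settles_project settles_unique by blast
  then show ?thesis
    unfolding odometer_space_iff using limit_map_eq(1)[OF True] by blast
next
  case False
  have "\<Gamma> n = \<Gamma> (Suc n) <#> \<Gamma> n" for n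
    using lcoset_project[OF one_closed, of n "Suc n"] lcos_mult_one[OF subgroup.subset[OF subgroup_\<Gamma>]]
    by simp
  moreover have "limit_map p = \<Gamma>" using False unfolding limit_map_def by auto
  ultimately show ?thesis
    unfolding odometer_space_iff using \<Gamma>_in_lcosets by simp
qed

lemma limit_map_measurable: "limit_map \<in> measurable \<mu> (borel_on (odometer_topology G \<Gamma>))"
proof (rule measurable_odometer)
  show "limit_map p \<in> odometer_space G \<Gamma>" for p by (rule limit_map_in_space)
  fix n A
  let ?good = "{p \<in> space \<mu>. \<forall>n. \<exists>A\<in>lcosets (\<Gamma> n). settles n A p}"
  have good: "?good \<in> sets \<mu>"
    using sets_settles finite_lcosets_\<Gamma>
    by (intro sets.sets_Collect_countable_All sets.sets_Collect_finite_Ex) auto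
  have "{p \<in> space \<mu>. limit_map p n = A} =
      (?good \<inter> {p \<in> space \<mu>. settles n A p}) \<union> (if A = \<Gamma> n then space \<mu> - ?good else {})"
  proof (rule Set.set_eqI)
    fix p
    show "p \<in> {p \<in> space \<mu>. limit_map p n = A} \<longleftrightarrow>
      p \<in> (?good \<inter> {p \<in> space \<mu>. settles n A p}) \<union> (if A = \<Gamma> n then space \<mu> - ?good else {})"
    proof (cases "\<forall>n. \<exists>A\<in>lcosets (\<Gamma> n). settles n A p")
      case True
      have "limit_map p n = A \<longleftrightarrow> settles n A p"
        using limit_map_eq(2)[OF True] settles_unique by blast
      then show ?thesis using True by auto
    next
      case False
      then have "limit_map p n = \<Gamma> n" unfolding limit_map_def by auto
      then show ?thesis using False by auto
    qed
  qed
  then show "{p \<in> space \<mu>. limit_map p n = A} \<in> sets \<mu>"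
    using good sets_settles by auto
qed

lemma limit_map_equivariant:
  assumes g: "g \<in> carrier G"
  shows "AE p in \<mu>. p \<in> CF_dom_all G C F \<longrightarrow>
    limit_map (act g p) = odometer_action G g (limit_map p)"
  using AE_settles
proof (rule AE_mp, intro AE_I2 impI)
  fix p assume p: "\<forall>n. \<exists>A\<in>lcosets (\<Gamma> n). settles n A p" "p \<in> CF_dom_all G C F"
  have dom: "p \<in> CF_dom G C F g" using p(2) g unfolding CF_dom_all_def by blast
  have s: "settles n (g <# limit_map p n) (act g p)" for n
    using settles_act[OF limit_map_eq(2)[OF p(1)] g dom] .
  moreover have "g <# limit_map p n \<in> lcosets (\<Gamma> n)" for n
    using lcosets_act[OF subgroup_\<Gamma> limit_map_eq(1)[OF p(1)] g] .
  \<comment> \<open>The limits exist at \<open>act g p\<close> as well, so \<open>limit_map\<close>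
    does not take its default value there and uniqueness of limits applies.\<close>
  ultimately have "\<forall>n. \<exists>A\<in>lcosets (\<Gamma> n). settles n A (act g p)" by blast
  from limit_map_eq(2)[OF this] s show "limit_map (act g p) = odometer_action G g (limit_map p)"
    unfolding odometer_action_def by (intro ext) (rule settles_unique)
qed

lemma has_factor: "has_nonsingular_odometer_factor G C F \<mu>"
  unfolding has_nonsingular_odometer_factor_def
  using odometer limit_map_measurable limit_map_equivariant by blast

end

subsection \<open>From an odometer factor to a compatible telescoping\<close>

locale CF_factor = CF_odometer G C F \<kappa> \<nu> \<mu> \<Gamma>
  for G :: "('a, 'b) monoid_scheme" (structure) and C F \<kappa> \<nu> \<mu> \<Gamma> +
  fixes \<phi> :: "(nat \<times> (nat \<Rightarrow> 'a)) set \<Rightarrow> nat \<Rightarrow> 'a set"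
  assumes \<phi>_measurable: "\<phi> \<in> measurable \<mu> (borel_on (odometer_topology G \<Gamma>))"
    and \<phi>_equivariant: "\<And>g. g \<in> carrier G \<Longrightarrow> AE p in \<mu>. p \<in> CF_dom_all G C F \<longrightarrow>
      \<phi> (CF_action G C F g p) = odometer_action G g (\<phi> p)"
begin

lemma \<phi>_space: "p \<in> space \<mu> \<Longrightarrow> \<phi> p \<in> odometer_space G \<Gamma>"
  using measurable_space[OF \<phi>_measurable] by (simp add: space_borel_on topspace_odometer)

lemma \<phi>_lcosets: "p \<in> space \<mu> \<Longrightarrow> \<phi> p n \<in> lcosets (\<Gamma> n)"
  using \<phi>_space odometer_space_iff by blast

lemma \<phi>_project: "p \<in> space \<mu> \<Longrightarrow> m \<le> n \<Longrightarrow> \<phi> p m = \<phi> p n <#> \<Gamma> m"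
  using \<phi>_space odometer_space_project by blast

lemma sets_\<phi>_eq: "A \<in> lcosets (\<Gamma> n) \<Longrightarrow> {p \<in> space \<mu>. \<phi> p n = A} \<in> sets \<mu>"
  by (rule measurable_coordinate[OF \<phi>_measurable])

lemma cyl_space: "p \<in> cyl n f \<Longrightarrow> p \<in> space \<mu>"
  using cyl_subset_space space_\<mu> by blast

text \<open>The exceptional set on which the \<open>n\<close>-th odometer coordinate differs from
  the expected coset \<open>A\<close>.\<close>

definition off :: "nat \<Rightarrow> 'a set \<Rightarrow> (nat \<times> (nat \<Rightarrow> 'a)) set set" where
  "off n A = {p \<in> space \<mu>. \<phi> p n \<noteq> A}"

lemma sets_off: "A \<in> lcosets (\<Gamma> n) \<Longrightarrow> off n A \<in> sets \<mu>"
  unfolding off_def using sets.compl_sets[OF sets_\<phi>_eq, of A n]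
  by (rule back_subst[of "\<lambda>S. S \<in> sets \<mu>"]) auto

lemma AE_\<phi>_act:
  assumes "g \<in> carrier G"
  shows "AE p in \<mu>. \<forall>n. \<phi> (act g p) n = g <# \<phi> p n"
  using AE_CF_dom_all \<phi>_equivariant[OF assms]
  by eventually_elim (simp add: odometer_action_def)

text \<open>A density point argument finds a cylinder on which \<open>\<phi>\<close> is nearly
  constant at index \<open>n\<close>; equivariance moves it to first coordinate
  \<open>\<one>\<close> without changing relative measure.\<close>

lemma concentration:
  assumes \<epsilon>: "\<epsilon> > 0"
  shows "\<exists>m\<ge>N. \<exists>A\<in>lcosets (\<Gamma> n). emeasure \<mu> (cyl m \<one> \<inter> off n A) \<le> ennreal (\<epsilon> * wt m \<one>)"
proof -
  \<comment> \<open>Finitely many cosets partition a cylinder of positive measure, so one of them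
    must carry positive measure.\<close>
  have "\<exists>A\<in>lcosets (\<Gamma> n). emeasure \<mu> (cyl 0 \<one> \<inter> {p \<in> space \<mu>. \<phi> p n = A}) > 0"
  proof (rule ccontr)
    assume "\<not> ?thesis"
    then have "cyl 0 \<one> \<inter> {p \<in> space \<mu>. \<phi> p n = A} \<in> null_sets \<mu>" if "A \<in> lcosets (\<Gamma> n)" for A
      using that sets_\<phi>_eq by (auto simp: null_sets_def)
    then have "(\<Union>A\<in>lcosets (\<Gamma> n). cyl 0 \<one> \<inter> {p \<in> space \<mu>. \<phi> p n = A}) \<in> null_sets \<mu>"
      using finite_lcosets_\<Gamma> by (intro null_sets_UN' countable_finite) auto
    moreover have "(\<Union>A\<in>lcosets (\<Gamma> n). cyl 0 \<one> \<inter> {p \<in> space \<mu>. \<phi> p n = A}) = cyl 0 \<one>"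
      using \<phi>_lcosets[of _ n] cyl_space[of _ 0 \<one>] by auto
    ultimately have "emeasure \<mu> (cyl 0 \<one>) = 0" by auto
    then show False
      using emeasure_cyl[OF one_F, of 0] wt_pos[OF one_F, of 0] by simp
  qed
  then obtain A where A: "A \<in> lcosets (\<Gamma> n)"
    "emeasure \<mu> (cyl 0 \<one> \<inter> {p \<in> space \<mu>. \<phi> p n = A}) > 0" by blast
  let ?E = "{p \<in> space \<mu>. \<phi> p n = A}"
  obtain m f where m: "m \<ge> N" "f \<in> F m" "emeasure \<mu> (cyl m f - ?E) \<le> ennreal (\<epsilon> * wt m f)"
    using dense_cylinder[OF sets_\<phi>_eq[OF A(1)] A(2) \<epsilon>] by blast
  have f: "f \<in> carrier G" using F_closed m(2) by blast
  let ?A = "inv f <# A"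
  have A': "?A \<in> lcosets (\<Gamma> n)"
    using lcosets_act[OF subgroup_\<Gamma> A(1)] f by simp
  have gf: "inv f \<otimes> f \<in> F m" using f one_F by simp
  \<comment> \<open>By equivariance, \<open>\<phi> p n = A\<close> gives the value \<open>?A\<close>
    at \<open>act (inv f) p\<close> for almost every \<open>p\<close>; points sent into
    \<open>off n ?A\<close> are therefore exceptional already.\<close>
  have "emeasure \<mu> {p \<in> cyl m f. act (inv f) p \<in> off n ?A} \<le> emeasure \<mu> (cyl m f - ?E)"
  proof (rule emeasure_mono_AE)
    show "AE p in \<mu>. p \<in> {p \<in> cyl m f. act (inv f) p \<in> off n ?A} \<longrightarrow> p \<in> cyl m f - ?E"
      using AE_\<phi>_act[OF inv_closed[OF f]] by eventually_elim (auto simp: off_def)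
  qed (use sets_\<phi>_eq[OF A(1)] in auto)
  also note m(3)
  finally have "emeasure \<mu> {p \<in> cyl m f. act (inv f) p \<in> off n ?A} * wt m \<one> \<le> ennreal (\<epsilon> * wt m f) * wt m \<one>"
    by (rule mult_right_mono) simp
  \<comment> \<open>The translation scales measures by the ratio of the two cylinder weights, so the
    proportion \<open>\<epsilon>\<close> carries over.\<close>
  then have "emeasure \<mu> (cyl m \<one> \<inter> off n ?A) * wt m f \<le> ennreal (\<epsilon> * wt m f) * wt m \<one>"
    using emeasure_act_vimage[OF m(2) inv_closed[OF f] gf sets_off[OF A']] f by simp
  then have "ennreal (wt m f) * emeasure \<mu> (cyl m \<one> \<inter> off n ?A) \<le> ennreal (wt m f) * ennreal (\<epsilon> * wt m \<one>)"
    using \<epsilon> by (simp flip: ennreal_mult' add: mult_ac)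
  then have "emeasure \<mu> (cyl m \<one> \<inter> off n ?A) \<le> ennreal (\<epsilon> * wt m \<one>)"
    using wt_pos[OF m(2)] by (subst (asm) ennreal_mult_le_mult_iff) auto
  then show ?thesis using m(1) A' by blast
qed

text \<open>The cosets of \<open>\<Gamma> j\<close> on which \<open>\<phi>\<close> concentrates need not cohere; by compactness of the odometer
  they accumulate at a coherent sequence \<open>b\<close>.\<close>

lemma coherent_cosets:
  assumes A: "\<And>j. A j \<in> lcosets (\<Gamma> j)"
  shows "\<exists>b. \<forall>n. (b n \<in> lcosets (\<Gamma> n) \<and> infinite {j. n \<le> j \<and> A j <#> \<Gamma> n = b n}) \<and>
    b n = b (Suc n) <#> \<Gamma> n"
proof (rule dependent_nat_choice)
  have pigeon: "\<exists>b. b \<in> lcosets (\<Gamma> n) \<and> infinite {j \<in> J. A j <#> \<Gamma> n = b}"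
    if J: "infinite J" "\<And>j. j \<in> J \<Longrightarrow> n \<le> j" for n J
  proof -
    have sub: "(\<lambda>j. A j <#> \<Gamma> n) ` J \<subseteq> lcosets (\<Gamma> n)"
      using J(2) lcosets_project[OF A] by blast
    then have "finite ((\<lambda>j. A j <#> \<Gamma> n) ` J)"
      using finite_lcosets_\<Gamma> finite_subset by blast
    from pigeonhole_infinite[OF J(1) this] sub show ?thesis by blast
  qed
  show "\<exists>x. x \<in> lcosets (\<Gamma> 0) \<and> infinite {j. 0 \<le> j \<and> A j <#> \<Gamma> 0 = x}"
    using pigeon[of UNIV 0] by simp
  fix x n assume x: "x \<in> lcosets (\<Gamma> n) \<and> infinite {j. n \<le> j \<and> A j <#> \<Gamma> n = x}"
  \<comment> \<open>Without \<open>n\<close> all indices are at least \<open>Suc n\<close>, so the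
    cosets \<open>A j\<close> project to the next stage.\<close>
  let ?J = "{j. n \<le> j \<and> A j <#> \<Gamma> n = x} - {n}"
  have "infinite ?J" using x by simp
  then obtain b where b: "b \<in> lcosets (\<Gamma> (Suc n))" "infinite {j \<in> ?J. A j <#> \<Gamma> (Suc n) = b}"
    using pigeon[of ?J "Suc n"] by fastforce
  \<comment> \<open>A single index in the smaller set yields coherence: \<open>A j\<close> projects
    to both \<open>b\<close> and \<open>x\<close>, and projections compose.\<close>
  then obtain j where j: "j \<in> ?J" "A j <#> \<Gamma> (Suc n) = b"
    using infinite_imp_nonempty by blast
  have "x = b <#> \<Gamma> n"
    using j lcosets_project_project[OF A, of n "Suc n" j] by auto
  moreover have "infinite {j. Suc n \<le> j \<and> A j <#> \<Gamma> (Suc n) = b}"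
    by (rule infinite_super[OF _ b(2)]) auto
  ultimately show "\<exists>y. (y \<in> lcosets (\<Gamma> (Suc n)) \<and> infinite {j. Suc n \<le> j \<and> A j <#> \<Gamma> (Suc n) = y}) \<and>
      x = y <#> \<Gamma> n"
    using b(1) by blast
qed

text \<open>The finer coordinate determines the coarser one, so an error at index \<open>m\<close>
  forces an error at index \<open>n\<close>.\<close>

lemma off_mono:
  assumes "m \<le> n"
  shows "off m (A <#> \<Gamma> m) \<subseteq> off n A"
  using \<phi>_project[OF _ assms] unfolding off_def by auto

lemma concentrated_levels:
  obtains b q where "\<And>n. b n \<in> lcosets (\<Gamma> n)" "\<And>n. b n = b (Suc n) <#> \<Gamma> n"
    "q 0 = 0" "strict_mono q"
    "\<And>n. emeasure \<mu> (cyl (q n) \<one> \<inter> off n (b n)) \<le> ennreal ((1/2) ^ n * wt (q n) \<one>)"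
proof -
  have "\<forall>j. \<exists>m A. j \<le> m \<and> A \<in> lcosets (\<Gamma> j) \<and>
      emeasure \<mu> (cyl m \<one> \<inter> off j A) \<le> ennreal ((1/2) ^ j * wt m \<one>)"
    using concentration[of "(1/2) ^ j" j j for j] by fastforce
  then obtain m A where mA: "\<And>j. j \<le> m j" "\<And>j. A j \<in> lcosets (\<Gamma> j)"
    "\<And>j. emeasure \<mu> (cyl (m j) \<one> \<inter> off j (A j)) \<le> ennreal ((1/2) ^ j * wt (m j) \<one>)"
    by metis
  obtain b where b': "\<forall>n. (b n \<in> lcosets (\<Gamma> n) \<and> infinite {j. n \<le> j \<and> A j <#> \<Gamma> n = b n}) \<and>
      b n = b (Suc n) <#> \<Gamma> n"
    using coherent_cosets[of A, OF mA(2)] by (rule exE)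
  then have b: "b n \<in> lcosets (\<Gamma> n)" "infinite {j. n \<le> j \<and> A j <#> \<Gamma> n = b n}"
    "b n = b (Suc n) <#> \<Gamma> n" for n
    using spec[OF b', of n] by blast+
  let ?P = "\<lambda>n k. emeasure \<mu> (cyl k \<one> \<inter> off n (b n)) \<le> ennreal ((1/2) ^ n * wt k \<one>)"
  \<comment> \<open>The required start \<open>q 0 = 0\<close> is compatible with the bound because
    at \<open>n = 0\<close> the allowed proportion is the whole cylinder.\<close>
  have "\<exists>q. \<forall>n. ((n = 0 \<longrightarrow> q n = 0) \<and> ?P n (q n)) \<and> q n < q (Suc n)"
  proof (rule dependent_nat_choice)
    have "emeasure \<mu> (cyl 0 \<one> \<inter> off 0 (b 0)) \<le> emeasure \<mu> (cyl 0 \<one>)"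
      by (rule emeasure_mono) auto
    then have "?P 0 0" using emeasure_cyl[OF one_F, of 0] by simp
    then show "\<exists>x. (0 = (0::nat) \<longrightarrow> x = 0) \<and> ?P 0 x" by blast
    fix k n :: nat
    \<comment> \<open>Infinitely many \<open>A j\<close> project to \<open>b (Suc n)\<close>. A
      large such \<open>j\<close> gives a level \<open>m j\<close> above \<open>k\<close>, and by
      \<open>off_mono\<close> its exceptional set contains the one needed here.\<close>
    obtain j where j: "j > max k n" "Suc n \<le> j" "A j <#> \<Gamma> (Suc n) = b (Suc n)"
      using b(2)[of "Suc n"] unfolding infinite_nat_iff_unbounded by blast
    have "emeasure \<mu> (cyl (m j) \<one> \<inter> off (Suc n) (b (Suc n))) \<le> emeasure \<mu> (cyl (m j) \<one> \<inter> off j (A j))"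
      using off_mono[OF j(2), of "A j"] j(3) sets_off[OF mA(2)] by (intro emeasure_mono) auto
    also have "\<dots> \<le> ennreal ((1/2) ^ j * wt (m j) \<one>)" by (rule mA(3))
    also have "\<dots> \<le> ennreal ((1/2) ^ Suc n * wt (m j) \<one>)"
      using j(2) by (intro ennreal_leI mult_right_mono power_decreasing) auto
    finally have "?P (Suc n) (m j)" .
    moreover have "k < m j" using j(1) mA(1)[of j] by simp
    ultimately show "\<exists>y. ((Suc n = 0 \<longrightarrow> y = 0) \<and> ?P (Suc n) y) \<and> k < y" by blast
  qed
  then obtain q where q: "\<And>n. n = 0 \<longrightarrow> q n = 0" "\<And>n. ?P n (q n)" "\<And>n. q n < q (Suc n)" by blast
  show ?thesis
    by (rule that[OF b(1,3) _ _ q(2)]) (use q in \<open>auto simp: strict_mono_Suc_iff\<close>)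
qed

text \<open>If \<open>c\<close> does not stabilise \<open>B\<close>, then almost every point of
  \<open>cyl k c\<close> is exceptional itself or becomes exceptional after applying
  \<open>inv c\<close>. The first kind costs the proportion \<open>\<epsilon>\<close> of
  \<open>cyl m \<one>\<close>, the second \<open>\<epsilon>'\<close>.\<close>

lemma emeasure_block_bound:
  assumes mk: "m \<le> k" and b: "B \<in> lcosets (\<Gamma> n)" "B' \<in> lcosets (\<Gamma> (Suc n))" "B = B' <#> \<Gamma> n"
    and em: "emeasure \<mu> (cyl m \<one> \<inter> off n B) \<le> ennreal (\<epsilon> * wt m \<one>)"
    and ek: "emeasure \<mu> (cyl k \<one> \<inter> off (Suc n) B') \<le> ennreal (\<epsilon>' * wt k \<one>)"
    and pos: "\<epsilon> \<ge> 0" "\<epsilon>' \<ge> 0"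
  shows "emeasure (measure_pmf (conv m k)) {c \<in> word m k. c \<notin> {g \<in> carrier G. g <# B = B}} \<le> ennreal (\<epsilon> + \<epsilon>')"
proof -
  let ?S = "{c \<in> word m k. c \<notin> {g \<in> carrier G. g <# B = B}}"
  have finS: "finite ?S" using finite_word[OF mk] by simp
  have SF: "c \<in> F k" if "c \<in> ?S" for c using word_in_F[OF mk] that by blast
  let ?X = "\<lambda>c. cyl k c \<inter> off n B"
  let ?Y = "\<lambda>c. {p \<in> cyl k c. act (inv c) p \<in> off (Suc n) B'}"
  \<comment> \<open>\<open>inv c\<close> carries \<open>cyl k c\<close> onto first coordinate
    \<open>\<one>\<close>, so the proportion \<open>\<epsilon>'\<close> assumed at
    \<open>cyl k \<one>\<close> is inherited by \<open>cyl k c\<close>.\<close>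
  have Y: "?Y c \<in> sets \<mu> \<and> emeasure \<mu> (?Y c) \<le> ennreal (\<epsilon>' * wt k c)" if c: "c \<in> ?S" for c
  proof -
    have cc: "c \<in> carrier G" using F_closed[OF SF[OF c]] .
    have gc: "inv c \<otimes> c \<in> F k" using cc one_F by simp
    have "emeasure \<mu> (?Y c) * wt k \<one> = emeasure \<mu> (cyl k \<one> \<inter> off (Suc n) B') * wt k c"
      using emeasure_act_vimage[OF SF[OF c] inv_closed[OF cc] gc sets_off[OF b(2)]] cc by simp
    also have "\<dots> \<le> ennreal (\<epsilon>' * wt k \<one>) * wt k c"
      using ek by (rule mult_right_mono) simp
    finally have "ennreal (wt k \<one>) * emeasure \<mu> (?Y c) \<le> ennreal (wt k \<one>) * ennreal (\<epsilon>' * wt k c)"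
      using pos by (simp flip: ennreal_mult' add: mult_ac)
    then have "emeasure \<mu> (?Y c) \<le> ennreal (\<epsilon>' * wt k c)"
      using wt_pos[OF one_F, of k] by (subst (asm) ennreal_mult_le_mult_iff) auto
    then show ?thesis
      using act_vimage_sets[OF SF[OF c] inv_closed[OF cc] gc sets_off[OF b(2)]] by blast
  qed
  have X: "?X c \<in> sets \<mu>" for c using sets_off[OF b(1)] by auto
  have cov: "ennreal (wt k c) \<le> emeasure \<mu> (?X c) + emeasure \<mu> (?Y c)" if c: "c \<in> ?S" for c
  proof -
    have cc: "c \<in> carrier G" using F_closed[OF SF[OF c]] .
    have act_sp: "act (inv c) p \<in> space \<mu>" if "p \<in> cyl k c" for p
      using CF_action_cyl[OF that inv_closed[OF cc]] cc one_F cyl_space by simp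
    have "emeasure \<mu> (cyl k c) \<le> emeasure \<mu> (?X c \<union> ?Y c)"
    proof (rule emeasure_mono_AE)
      show "AE p in \<mu>. p \<in> cyl k c \<longrightarrow> p \<in> ?X c \<union> ?Y c"
        using AE_\<phi>_act[OF inv_closed[OF cc]]
      proof eventually_elim
        fix p assume eq: "\<forall>n. \<phi> (act (inv c) p) n = inv c <# \<phi> p n"
        have False if p: "p \<in> cyl k c" "p \<notin> ?X c" "p \<notin> ?Y c"
        proof -
          have 1: "\<phi> p n = B" using p cyl_space unfolding off_def by blast
          have "\<phi> (act (inv c) p) (Suc n) = B'"
            using p act_sp unfolding off_def by blast
          \<comment> \<open>Off both exceptional sets the value at \<open>p\<close> is
            \<open>B\<close>, while the value \<open>B'\<close> at the translated point projects to
            \<open>B\<close>; equivariance equates \<open>inv c <# B\<close> with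
            \<open>B\<close>.\<close>
          then have "inv c <# B = B"
            using \<phi>_project[OF act_sp[OF p(1)], of n "Suc n"] eq 1 b(3) by simp
          moreover have Bc: "B \<subseteq> carrier G" using lcosets_subset[OF subgroup_\<Gamma> b(1)] .
          ultimately have "c <# B = B"
            using lcos_m_assoc[OF Bc cc inv_closed[OF cc]] lcos_mult_one[OF Bc] cc by simp
          then show False using c cc by blast
        qed
        then show "p \<in> cyl k c \<longrightarrow> p \<in> ?X c \<union> ?Y c" by blast
      qed
      show "?X c \<union> ?Y c \<in> sets \<mu>" using X Y[OF c] by blast
    qed
    also have "\<dots> \<le> emeasure \<mu> (?X c) + emeasure \<mu> (?Y c)"
      using X Y[OF c] by (intro emeasure_subadditive) auto
    finally show ?thesis using emeasure_cyl[OF SF[OF c]] by simp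
  qed
  have block: "(\<Sum>c\<in>?S. ennreal (wt k c)) = wt m \<one> * emeasure (measure_pmf (conv m k)) ?S"
  proof -
    have "(\<Sum>c\<in>?S. ennreal (wt k c)) = emeasure \<mu> (\<Union>c\<in>?S. cyl k c)"
      using emeasure_Union_cyl[of ?S k] SF by (simp add: subset_iff)
    also have "(\<Union>c\<in>?S. cyl k c) = (\<Union>c\<in>?S. cyl k (\<one> \<otimes> c))"
      using word_closed by (intro SUP_cong) auto
    also have "emeasure \<mu> \<dots> = wt m \<one> * emeasure (measure_pmf (conv m k)) ?S"
      by (rule emeasure_block[OF mk one_F]) blast
    finally show ?thesis .
  qed
  \<comment> \<open>The first kind is counted once, since the cylinders \<open>cyl k c\<close> are
    disjoint parts of \<open>cyl m \<one>\<close>.\<close>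
  have sumX: "(\<Sum>c\<in>?S. emeasure \<mu> (?X c)) \<le> ennreal (\<epsilon> * wt m \<one>)"
  proof -
    have "disjoint_family_on ?X ?S"
      using cyl_disjoint[of _ _ k] unfolding disjoint_family_on_def by blast
    then have "(\<Sum>c\<in>?S. emeasure \<mu> (?X c)) = emeasure \<mu> (\<Union>c\<in>?S. ?X c)"
      using X finS by (intro sum_emeasure) auto
    also have "\<dots> \<le> emeasure \<mu> (cyl m \<one> \<inter> off n B)"
    proof (rule emeasure_mono)
      have "cyl k c \<subseteq> cyl m \<one>" if "c \<in> ?S" for c
        using that word_closed[of c m k] unfolding cyl_split[OF mk one_F] by fastforce
      then show "(\<Union>c\<in>?S. ?X c) \<subseteq> cyl m \<one> \<inter> off n B" by blast
      show "cyl m \<one> \<inter> off n B \<in> sets \<mu>" using sets_off[OF b(1)] by auto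
    qed
    finally show ?thesis using em by (rule order_trans)
  qed
  \<comment> \<open>The second kind takes the proportion \<open>\<epsilon>'\<close> of each
    \<open>cyl k c\<close>, and these cylinders together weigh at most
    \<open>wt m \<one>\<close>.\<close>
  have sumY: "(\<Sum>c\<in>?S. emeasure \<mu> (?Y c)) \<le> ennreal (\<epsilon>' * wt m \<one>)"
  proof -
    have "(\<Sum>c\<in>?S. emeasure \<mu> (?Y c)) \<le> (\<Sum>c\<in>?S. ennreal \<epsilon>' * ennreal (wt k c))"
      using Y pos by (intro sum_mono) (simp add: ennreal_mult')
    also have "\<dots> = ennreal \<epsilon>' * (wt m \<one> * emeasure (measure_pmf (conv m k)) ?S)"
      by (simp only: block sum_distrib_left[symmetric])
    also have "\<dots> \<le> ennreal \<epsilon>' * (ennreal (wt m \<one>) * 1)"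
      by (intro mult_left_mono measure_pmf.emeasure_le_1) simp_all
    finally show ?thesis using pos by (simp add: ennreal_mult')
  qed
  have "wt m \<one> * emeasure (measure_pmf (conv m k)) ?S \<le>
      (\<Sum>c\<in>?S. emeasure \<mu> (?X c) + emeasure \<mu> (?Y c))"
    unfolding block[symmetric] by (rule sum_mono) (rule cov)
  also have "\<dots> \<le> ennreal (\<epsilon> * wt m \<one>) + ennreal (\<epsilon>' * wt m \<one>)"
    unfolding sum.distrib by (rule add_mono[OF sumX sumY])
  also have "\<dots> = ennreal (wt m \<one>) * ennreal (\<epsilon> + \<epsilon>')"
    using pos by (simp flip: ennreal_mult' ennreal_plus add: algebra_simps)
  finally show ?thesis
    using wt_pos[OF one_F, of m] by (subst (asm) ennreal_mult_le_mult_iff) auto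
qed

text \<open>The new subgroups are the stabilisers of the coherent cosets \<open>b n\<close>; the
  block bounds at consecutive levels are dominated by a geometric series.\<close>

lemma exists_compatible_telescoping:
  "\<exists>\<Gamma>'. odometer_sequence G \<Gamma>' \<and> (\<exists>q :: nat \<Rightarrow> nat. q 0 = 0 \<and> strict_mono q \<and>
    (\<Sum>n. emeasure (measure_pmf (conv (q n) (q (Suc n)))) {c \<in> word (q n) (q (Suc n)). c \<notin> \<Gamma>' n}) \<noteq> \<infinity>)"
proof -
  obtain b q where b: "\<And>n. b n \<in> lcosets (\<Gamma> n)" "\<And>n. b n = b (Suc n) <#> \<Gamma> n"
    and q: "q 0 = 0" "strict_mono q"
    and c: "\<And>n. emeasure \<mu> (cyl (q n) \<one> \<inter> off n (b n)) \<le> ennreal ((1/2) ^ n * wt (q n) \<one>)"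
    using concentrated_levels by blast
  let ?S = "\<lambda>n. {g \<in> carrier G. g <# b n = b n}"
  have le: "emeasure (measure_pmf (conv (q n) (q (Suc n)))) {c \<in> word (q n) (q (Suc n)). c \<notin> ?S n}
      \<le> ennreal ((1/2) ^ n + (1/2) ^ Suc n)" for n
    using q(2) by (intro emeasure_block_bound[OF _ b(1) b(1) b(2) c c]) (auto simp: strict_mono_less_eq)
  have sm: "summable (\<lambda>n. (1/2) ^ n + (1/2) ^ Suc n :: real)"
    by (intro summable_add summable_geometric summable_mult) (auto intro!: summable_mult summable_geometric)
  have "(\<Sum>n. emeasure (measure_pmf (conv (q n) (q (Suc n)))) {c \<in> word (q n) (q (Suc n)). c \<notin> ?S n})
      \<le> (\<Sum>n. ennreal ((1/2) ^ n + (1/2) ^ Suc n))"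
    by (intro suminf_le le) auto
  also have "\<dots> = ennreal (\<Sum>n. (1/2) ^ n + (1/2) ^ Suc n)"
    by (rule suminf_ennreal2[OF _ sm]) simp
  finally have "(\<Sum>n. emeasure (measure_pmf (conv (q n) (q (Suc n)))) {c \<in> word (q n) (q (Suc n)). c \<notin> ?S n}) \<noteq> \<infinity>"
    by (auto simp: top_unique)
  then show ?thesis
    using odometer_sequence_stabilizers[OF odometer b] q by blast
qed

end

section \<open>Odometer factors and compatible telescopings\<close>

theorem corollary4p6:
  fixes G :: "('a, 'b) monoid_scheme"
    and C F :: "nat \<Rightarrow> 'a set" and \<kappa> :: "nat \<Rightarrow> 'a pmf" and \<nu> :: "nat \<Rightarrow> 'a measure"
    and \<mu> :: "(nat \<times> (nat \<Rightarrow> 'a)) set measure"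
  assumes "group G" and "countable (carrier G)" and "infinite (carrier G)"
    and "residually_finite G"
    and "CF_parameters G C F \<kappa> \<nu>" and "CF_admissible G C F \<nu>"
    and "is_CF_measure G C F \<nu> \<mu>"
  shows "\<not> has_nonsingular_odometer_factor G C F \<mu> \<longleftrightarrow>
    (\<forall>\<Gamma>. odometer_sequence G \<Gamma> \<longrightarrow>
      (\<forall>q :: nat \<Rightarrow> nat. q 0 = 0 \<and> strict_mono q \<longrightarrow>
        (\<Sum>n. emeasure (measure_pmf (conv_range G \<kappa> (q n) (q (Suc n))))
               {c \<in> set_range_prod G C (q n) (q (Suc n)). c \<notin> \<Gamma> n}) = \<infinity>))"
proof -
  interpret CF_parameters G C F \<kappa> \<nu> by fact
  interpret CF_system G C F \<kappa> \<nu> \<mu>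
    by unfold_locales fact+
  show ?thesis
  proof (intro iffI allI impI)
    fix \<Gamma> and q :: "nat \<Rightarrow> nat"
    assume no: "\<not> has_nonsingular_odometer_factor G C F \<mu>" and \<Gamma>: "odometer_sequence G \<Gamma>"
      and q: "q 0 = 0 \<and> strict_mono q"
    show "(\<Sum>n. emeasure (measure_pmf (conv (q n) (q (Suc n)))) {c \<in> word (q n) (q (Suc n)). c \<notin> \<Gamma> n}) = \<infinity>"
    proof (rule ccontr)
      assume "\<not> ?thesis"
      \<comment> \<open>A finite sum says that the telescoping along \<open>q\<close> is compatible
        with \<open>\<Gamma>\<close>, which produces an odometer factor.\<close>
      then interpret CF_compatible G C F \<kappa> \<nu> \<mu> \<Gamma> q
        using \<Gamma> q by unfold_locales auto
      show False using has_factor no by blast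
    qed
  next
    assume all: "\<forall>\<Gamma>. odometer_sequence G \<Gamma> \<longrightarrow> (\<forall>q :: nat \<Rightarrow> nat. q 0 = 0 \<and> strict_mono q \<longrightarrow>
        (\<Sum>n. emeasure (measure_pmf (conv (q n) (q (Suc n)))) {c \<in> word (q n) (q (Suc n)). c \<notin> \<Gamma> n}) = \<infinity>)"
    show "\<not> has_nonsingular_odometer_factor G C F \<mu>"
    proof
      assume "has_nonsingular_odometer_factor G C F \<mu>"
      then obtain \<Gamma> \<phi> where \<Gamma>: "odometer_sequence G \<Gamma>"
        "\<phi> \<in> measurable \<mu> (borel_on (odometer_topology G \<Gamma>))"
        "\<And>g. g \<in> carrier G \<Longrightarrow> AE p in \<mu>. p \<in> CF_dom_all G C F \<longrightarrow>
          \<phi> (CF_action G C F g p) = odometer_action G g (\<phi> p)"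
        unfolding has_nonsingular_odometer_factor_def by blast
      \<comment> \<open>The compatible telescoping obtained from a factor belongs in general to a
        sequence of conjugates of the \<open>\<Gamma> n\<close>, so the assumption is used for that
        sequence and not for \<open>\<Gamma>\<close> itself.\<close>
      then interpret CF_factor G C F \<kappa> \<nu> \<mu> \<Gamma> \<phi>
        by unfold_locales auto
      show False using exists_compatible_telescoping all by blast
    qed
  qed
qed

end
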